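(* Let $M$ be a $2m$-dimensional almost Hermitian manifold with indefinite metric $g$ of signature $(2s,2(m-s))$, $0<s<m$, where $m>2$. Suppose that for each point $p\in M$ there exists a constant $c(p)$ such that the sectional curvature of every nondegenerate antiholomorphic 2-plane $\alpha$ in $T_pM$ is bounded from above by $c(p)$, i.e. $$K(\alpha)\le c(p).$$ Then $M$ is of pointwise constant antiholomorphic sectional curvature.
   Context: An almost Hermitian manifold is a smooth manifold $M$ with a (here pseudo-Riemannian) metric tensor $g$ and an almost complex structure $J$ satisfying $J^2=-\mathrm{id}$ and $g(X,Y)=g(JX,JY)$. Signature $(2s,2(m-s))$ means that each tangent space is isometric to $\mathbb{R}^{2m}$ with the inner product $-\sum_{i=1}^{2s}X^iY^i+\sum_{j=2s+1}^{2m}X^jY^j$. Let $\nabla$ be the Levi-Civita connection, $R(X,Y)=[\nabla_X,\nabla_Y]-\nabla_{[X,Y]}$ the curvature tensor, and $R(X,Y,Z,U)=g(R(X,Y)Z,U)$. A 2-plane $\alpha\subset T_pM$ is nondegenerate if the restriction of $g$ to $\alpha$ is nondegenerate, and antiholomorphic if $\alpha$ is perpendicular to $J\alpha$. The sectional curvature of a nondegenerate 2-plane $\alpha$ spanned by $X,Y$ is $$K(\alpha)=\frac{R(X,Y,Y,X)}{g(X,X)g(Y,Y)-g(X,Y)^2}.$$ $M$ is of pointwise constant antiholomorphic sectional curvature if for every $p\in M$ there is a constant $k(p)$ such that $K(\alpha)=k(p)$ for every nondegenerate antiholomorphic 2-plane $\alpha\subset T_pM$. *)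

theory Defs
  imports "HOL-Analysis.Analysis" "HOL-Library.Function_Algebras"
begin

text \<open>Pointwise scalar multiplication, so that the vector-space notions of the library
  (\<^const>\<open>span\<close>, \<^const>\<open>subspace\<close>, \<^const>\<open>dim\<close>) apply to tangent vectors, which are functionals.\<close>

instantiation "fun" :: (type, real_vector) real_vector
begin

definition scaleR_fun_def: "c *\<^sub>R f = (\<lambda>x. c *\<^sub>R f x)"

instance
  by standard (simp_all add: scaleR_fun_def fun_eq_iff algebra_simps)

end


section \<open>Smooth manifolds\<close>

text \<open>\<open>Ck_on k S f\<close>: \<open>f\<close> is of class $C^k$ on the open subset \<open>S\<close> of a Euclidean space.\<close>

primrec Ck_on :: "nat \<Rightarrow> 'e::euclidean_space set \<Rightarrow> ('e \<Rightarrow> 'f::real_normed_vector) \<Rightarrow> bool" where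
  "Ck_on 0 S f \<longleftrightarrow> continuous_on S f"
| "Ck_on (Suc k) S f \<longleftrightarrow>
     (\<forall>x\<in>S. f differentiable (at x)) \<and> (\<forall>v. Ck_on k S (\<lambda>x. frechet_derivative f (at x) v))"

definition smooth_on :: "'e::euclidean_space set \<Rightarrow> ('e \<Rightarrow> 'f::real_normed_vector) \<Rightarrow> bool" where
  "smooth_on S f \<longleftrightarrow> (\<forall>k. Ck_on k S f)"

text \<open>A chart is a pair of its domain and its coordinate map, whose values off the domain are
  irrelevant.\<close>

type_synonym ('a, 'e) chart = "'a set \<times> ('a \<Rightarrow> 'e)"

definition is_chart :: "'a topology \<Rightarrow> ('a, 'e::euclidean_space) chart \<Rightarrow> bool" where
  "is_chart M c \<longleftrightarrow> (case c of (U, \<phi>) \<Rightarrow>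
     openin M U \<and> open (\<phi> ` U) \<and>
     homeomorphic_map (subtopology M U) (top_of_set (\<phi> ` U)) \<phi>)"

definition smooth_manifold :: "'a topology \<Rightarrow> ('a, 'e::euclidean_space) chart set \<Rightarrow> bool" where
  "smooth_manifold M A \<longleftrightarrow>
     Hausdorff_space M \<and> second_countable M \<and>
     (\<forall>c\<in>A. is_chart M c) \<and> (\<Union>(U, \<phi>)\<in>A. U) = topspace M \<and>
     (\<forall>(U, \<phi>)\<in>A. \<forall>(V, \<psi>)\<in>A. smooth_on (\<phi> ` (U \<inter> V)) (\<psi> \<circ> inv_into U \<phi>))"

definition smooth_fun ::
  "('a, 'e::euclidean_space) chart set \<Rightarrow> 'a set \<Rightarrow> ('a \<Rightarrow> real) \<Rightarrow> bool" where
  "smooth_fun A W f \<longleftrightarrow> (\<forall>(U, \<phi>)\<in>A. smooth_on (\<phi> ` (U \<inter> W)) (f \<circ> inv_into U \<phi>))"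

definition smooth_near ::
  "'a topology \<Rightarrow> ('a, 'e::euclidean_space) chart set \<Rightarrow> 'a \<Rightarrow> ('a \<Rightarrow> real) \<Rightarrow> bool" where
  "smooth_near M A p f \<longleftrightarrow> (\<exists>W. openin M W \<and> p \<in> W \<and> smooth_fun A W f)"


section \<open>Tangent vectors and vector fields\<close>

text \<open>A tangent vector at \<open>p\<close> is a directional derivative $\sum_i w^i\,\partial/\partial x^i|_p$
  acting on the functions that are smooth near \<open>p\<close>. As functionals in HOL are total, they are
  given the value 0 on all other functions; equality of tangent vectors is then equality.\<close>

type_synonym 'a tvec = "('a \<Rightarrow> real) \<Rightarrow> real"

type_synonym 'a vfield = "'a \<Rightarrow> 'a tvec"

definition dir_deriv ::
  "'a topology \<Rightarrow> ('a, 'e::euclidean_space) chart set \<Rightarrow> 'a \<Rightarrow> ('a, 'e) chart \<Rightarrow> 'e \<Rightarrow> 'a tvec" where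
  "dir_deriv M A p c w = (case c of (U, \<phi>) \<Rightarrow>
     (\<lambda>f. if smooth_near M A p f
          then frechet_derivative (f \<circ> inv_into U \<phi>) (at (\<phi> p)) w else 0))"

definition tangent_space ::
  "'a topology \<Rightarrow> ('a, 'e::euclidean_space) chart set \<Rightarrow> 'a \<Rightarrow> 'a tvec set" where
  "tangent_space M A p = {dir_deriv M A p c w | c w. c \<in> A \<and> p \<in> fst c}"

definition smooth_vfield ::
  "'a topology \<Rightarrow> ('a, 'e::euclidean_space) chart set \<Rightarrow> 'a set \<Rightarrow> 'a vfield \<Rightarrow> bool" where
  "smooth_vfield M A W X \<longleftrightarrow>
     (\<forall>p\<in>W. X p \<in> tangent_space M A p) \<and>
     (\<forall>V f. openin M V \<and> V \<subseteq> W \<and> smooth_fun A V f \<longrightarrow> smooth_fun A V (\<lambda>p. X p f))"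

definition lie_bracket ::
  "'a topology \<Rightarrow> ('a, 'e::euclidean_space) chart set \<Rightarrow> 'a vfield \<Rightarrow> 'a vfield \<Rightarrow> 'a vfield" where
  "lie_bracket M A X Y = (\<lambda>p f. if smooth_near M A p f
     then X p (\<lambda>q. Y q f) - Y p (\<lambda>q. X q f) else 0)"


section \<open>Almost Hermitian manifolds with indefinite metric\<close>

text \<open>Tensor fields are families of maps on tangent spaces; only their values on tangent vectors
  matter.\<close>

definition pseudo_riemannian_metric ::
  "'a topology \<Rightarrow> ('a, 'e::euclidean_space) chart set \<Rightarrow> ('a \<Rightarrow> 'a tvec \<Rightarrow> 'a tvec \<Rightarrow> real) \<Rightarrow> bool" where
  "pseudo_riemannian_metric M A g \<longleftrightarrow>
     (\<forall>p\<in>topspace M.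
        (\<forall>u\<in>tangent_space M A p. \<forall>v\<in>tangent_space M A p. g p u v = g p v u) \<and>
        (\<forall>u\<in>tangent_space M A p. \<forall>v\<in>tangent_space M A p. \<forall>w\<in>tangent_space M A p. \<forall>a b.
           g p (a *\<^sub>R u + b *\<^sub>R v) w = a * g p u w + b * g p v w) \<and>
        (\<forall>u\<in>tangent_space M A p. (\<forall>v\<in>tangent_space M A p. g p u v = 0) \<longrightarrow> u = 0)) \<and>
     (\<forall>W X Y. openin M W \<and> smooth_vfield M A W X \<and> smooth_vfield M A W Y \<longrightarrow>
        smooth_fun A W (\<lambda>p. g p (X p) (Y p)))"

text \<open>\<open>a\<close> minus signs and \<open>b\<close> plus signs; $\mathbb{R}^{a+b}$ is realised as the sequences
  supported in \<open>{..<a + b}\<close>.\<close>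

definition metric_signature ::
  "'a topology \<Rightarrow> ('a, 'e::euclidean_space) chart set \<Rightarrow> ('a \<Rightarrow> 'a tvec \<Rightarrow> 'a tvec \<Rightarrow> real)
     \<Rightarrow> nat \<Rightarrow> nat \<Rightarrow> bool" where
  "metric_signature M A g a b \<longleftrightarrow>
     (\<forall>p\<in>topspace M. \<exists>L :: (nat \<Rightarrow> real) \<Rightarrow> 'a tvec.
        linear L \<and> bij_betw L {x. \<forall>i\<ge>a + b. x i = 0} (tangent_space M A p) \<and>
        (\<forall>x y. (\<forall>i\<ge>a + b. x i = 0) \<and> (\<forall>i\<ge>a + b. y i = 0) \<longrightarrow>
           g p (L x) (L y) = - (\<Sum>i<a. x i * y i) + (\<Sum>j=a..<a + b. x j * y j)))"

definition almost_complex_structure ::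
  "'a topology \<Rightarrow> ('a, 'e::euclidean_space) chart set \<Rightarrow> ('a \<Rightarrow> 'a tvec \<Rightarrow> 'a tvec) \<Rightarrow> bool" where
  "almost_complex_structure M A J \<longleftrightarrow>
     (\<forall>p\<in>topspace M.
        (\<forall>u\<in>tangent_space M A p. J p u \<in> tangent_space M A p \<and> J p (J p u) = - u) \<and>
        (\<forall>u\<in>tangent_space M A p. \<forall>v\<in>tangent_space M A p. \<forall>a b.
           J p (a *\<^sub>R u + b *\<^sub>R v) = a *\<^sub>R J p u + b *\<^sub>R J p v)) \<and>
     (\<forall>W X. openin M W \<and> smooth_vfield M A W X \<longrightarrow> smooth_vfield M A W (\<lambda>p. J p (X p)))"

definition almost_hermitian_manifold ::
  "'a topology \<Rightarrow> ('a, 'e::euclidean_space) chart set \<Rightarrow> ('a \<Rightarrow> 'a tvec \<Rightarrow> 'a tvec \<Rightarrow> real)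
     \<Rightarrow> ('a \<Rightarrow> 'a tvec \<Rightarrow> 'a tvec) \<Rightarrow> bool" where
  "almost_hermitian_manifold M A g J \<longleftrightarrow>
     smooth_manifold M A \<and> pseudo_riemannian_metric M A g \<and> almost_complex_structure M A J \<and>
     (\<forall>p\<in>topspace M. \<forall>u\<in>tangent_space M A p. \<forall>v\<in>tangent_space M A p.
        g p u v = g p (J p u) (J p v))"


section \<open>Levi-Civita connection and curvature\<close>

text \<open>A connection acts on the vector fields over every open set, not only on the global ones.
  Compatibility with restriction need not be required separately: multiplying a field on \<open>W\<close> by
  the indicator function of an open neighbourhood \<open>V \<subseteq> W\<close> of \<open>p\<close>, which is smooth on \<open>V\<close>, shows
  that \<open>D X Y p\<close> depends only on \<open>X\<close> and \<open>Y\<close> near \<open>p\<close>.\<close>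

definition affine_connection ::
  "'a topology \<Rightarrow> ('a, 'e::euclidean_space) chart set \<Rightarrow> ('a vfield \<Rightarrow> 'a vfield \<Rightarrow> 'a vfield) \<Rightarrow> bool" where
  "affine_connection M A D \<longleftrightarrow>
     (\<forall>W X Y. openin M W \<and> smooth_vfield M A W X \<and> smooth_vfield M A W Y \<longrightarrow>
        smooth_vfield M A W (D X Y) \<and>
        (\<forall>X'. smooth_vfield M A W X' \<longrightarrow> (\<forall>p\<in>W. D (X + X') Y p = D X Y p + D X' Y p)) \<and>
        (\<forall>Y'. smooth_vfield M A W Y' \<longrightarrow> (\<forall>p\<in>W. D X (Y + Y') p = D X Y p + D X Y' p)) \<and>
        (\<forall>f. smooth_fun A W f \<longrightarrow> (\<forall>p\<in>W.
           D (\<lambda>q. f q *\<^sub>R X q) Y p = f p *\<^sub>R D X Y p \<and>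
           D X (\<lambda>q. f q *\<^sub>R Y q) p = X p f *\<^sub>R Y p + f p *\<^sub>R D X Y p)))"

definition levi_civita_connection ::
  "'a topology \<Rightarrow> ('a, 'e::euclidean_space) chart set \<Rightarrow> ('a \<Rightarrow> 'a tvec \<Rightarrow> 'a tvec \<Rightarrow> real)
     \<Rightarrow> ('a vfield \<Rightarrow> 'a vfield \<Rightarrow> 'a vfield) \<Rightarrow> bool" where
  "levi_civita_connection M A g D \<longleftrightarrow>
     affine_connection M A D \<and>
     (\<forall>W X Y. openin M W \<and> smooth_vfield M A W X \<and> smooth_vfield M A W Y \<longrightarrow>
        (\<forall>p\<in>W. D X Y p - D Y X p = lie_bracket M A X Y p)) \<and>
     (\<forall>W X Y Z. openin M W \<and>
        smooth_vfield M A W X \<and> smooth_vfield M A W Y \<and> smooth_vfield M A W Z \<longrightarrow>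
        (\<forall>p\<in>W. X p (\<lambda>q. g q (Y q) (Z q)) = g p (D X Y p) (Z p) + g p (Y p) (D X Z p)))"

definition curvature_operator ::
  "'a topology \<Rightarrow> ('a, 'e::euclidean_space) chart set \<Rightarrow> ('a vfield \<Rightarrow> 'a vfield \<Rightarrow> 'a vfield)
     \<Rightarrow> 'a vfield \<Rightarrow> 'a vfield \<Rightarrow> 'a vfield \<Rightarrow> 'a vfield" where
  "curvature_operator M A D X Y Z = D X (D Y Z) - D Y (D X Z) - D (lie_bracket M A X Y) Z"

text \<open>The value on tangent vectors at \<open>p\<close> is obtained by extending them to smooth vector fields
  near \<open>p\<close>; by tensoriality the extensions do not matter.\<close>

definition curvature_at ::
  "'a topology \<Rightarrow> ('a, 'e::euclidean_space) chart set \<Rightarrow> ('a vfield \<Rightarrow> 'a vfield \<Rightarrow> 'a vfield)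
     \<Rightarrow> 'a \<Rightarrow> 'a tvec \<Rightarrow> 'a tvec \<Rightarrow> 'a tvec \<Rightarrow> 'a tvec" where
  "curvature_at M A D p x y z = (THE w. \<forall>W X Y Z.
     openin M W \<and> p \<in> W \<and>
     smooth_vfield M A W X \<and> smooth_vfield M A W Y \<and> smooth_vfield M A W Z \<and>
     X p = x \<and> Y p = y \<and> Z p = z \<longrightarrow> curvature_operator M A D X Y Z p = w)"

definition curvature_tensor ::
  "'a topology \<Rightarrow> ('a, 'e::euclidean_space) chart set \<Rightarrow> ('a \<Rightarrow> 'a tvec \<Rightarrow> 'a tvec \<Rightarrow> real)
     \<Rightarrow> ('a vfield \<Rightarrow> 'a vfield \<Rightarrow> 'a vfield)
     \<Rightarrow> 'a \<Rightarrow> 'a tvec \<Rightarrow> 'a tvec \<Rightarrow> 'a tvec \<Rightarrow> 'a tvec \<Rightarrow> real" where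
  "curvature_tensor M A g D p x y z u = g p (curvature_at M A D p x y z) u"


section \<open>Sectional curvature\<close>

definition tangent_plane ::
  "'a topology \<Rightarrow> ('a, 'e::euclidean_space) chart set \<Rightarrow> 'a \<Rightarrow> 'a tvec set \<Rightarrow> bool" where
  "tangent_plane M A p \<alpha> \<longleftrightarrow> subspace \<alpha> \<and> \<alpha> \<subseteq> tangent_space M A p \<and> dim \<alpha> = 2"

definition nondegenerate_on ::
  "('a \<Rightarrow> 'a tvec \<Rightarrow> 'a tvec \<Rightarrow> real) \<Rightarrow> 'a \<Rightarrow> 'a tvec set \<Rightarrow> bool" where
  "nondegenerate_on g p \<alpha> \<longleftrightarrow> (\<forall>u\<in>\<alpha>. (\<forall>v\<in>\<alpha>. g p u v = 0) \<longrightarrow> u = 0)"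

definition antiholomorphic ::
  "('a \<Rightarrow> 'a tvec \<Rightarrow> 'a tvec \<Rightarrow> real) \<Rightarrow> ('a \<Rightarrow> 'a tvec \<Rightarrow> 'a tvec) \<Rightarrow> 'a \<Rightarrow> 'a tvec set \<Rightarrow> bool" where
  "antiholomorphic g J p \<alpha> \<longleftrightarrow> (\<forall>u\<in>\<alpha>. \<forall>v\<in>J p ` \<alpha>. g p u v = 0)"

text \<open>For a nondegenerate tangent plane the quotient does not depend on the spanning pair.\<close>

definition sectional_curvature ::
  "'a topology \<Rightarrow> ('a, 'e::euclidean_space) chart set \<Rightarrow> ('a \<Rightarrow> 'a tvec \<Rightarrow> 'a tvec \<Rightarrow> real)
     \<Rightarrow> ('a vfield \<Rightarrow> 'a vfield \<Rightarrow> 'a vfield) \<Rightarrow> 'a \<Rightarrow> 'a tvec set \<Rightarrow> real" where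
  "sectional_curvature M A g D p \<alpha> = (THE K. \<forall>x y. span {x, y} = \<alpha> \<longrightarrow>
     K = curvature_tensor M A g D p x y y x / (g p x x * g p y y - (g p x y)\<^sup>2))"

definition pointwise_constant_antiholomorphic_curvature ::
  "'a topology \<Rightarrow> ('a, 'e::euclidean_space) chart set \<Rightarrow> ('a \<Rightarrow> 'a tvec \<Rightarrow> 'a tvec \<Rightarrow> real)
     \<Rightarrow> ('a \<Rightarrow> 'a tvec \<Rightarrow> 'a tvec) \<Rightarrow> ('a vfield \<Rightarrow> 'a vfield \<Rightarrow> 'a vfield) \<Rightarrow> bool" where
  "pointwise_constant_antiholomorphic_curvature M A g J D \<longleftrightarrow>
     (\<forall>p\<in>topspace M. \<exists>k. \<forall>\<alpha>.
        tangent_plane M A p \<alpha> \<and> nondegenerate_on g p \<alpha> \<and> antiholomorphic g J p \<alpha> \<longrightarrow>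
        sectional_curvature M A g D p \<alpha> = k)"

end

theory Submission
  imports Defs
begin

text \<open>
  Fix a point. Bounding $K$ from above on the planes spanned by $x$ and $y + t z$, where $x, y, z$ are
  orthogonal over the complex numbers and $y, z$ have opposite signs, forces the quadratic polynomial
  $t \mapsto R(x, y + tz, y + tz, x)$ to vanish at both values of $t$ for which $y + tz$ is isotropic,
  because the Gram determinant changes sign there. Comparing coefficients gives $K(x,y) = K(x,z)$ and
  the vanishing of the mixed term. As the metric is indefinite and $m > 2$, any two nondegenerate
  antiholomorphic planes can be joined by a chain of such exchanges, so $K$ is constant at the point.
  This uses only that $R$ is a tensor that is skew in its first and in its last two arguments.
\<close>

section \<open>Curvature on an indefinite Hermitian vector space\<close>

text \<open>The obstacle is the null vectors. A plane with vanishing Gram determinant has no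
  sectional curvature, and the orthogonal projection of a nonnull vector may be null, so a chain of
  exchanges can break. What rescues it is that projection along \<open>x\<close> never destroys a
  sign opposite to that of \<open>x\<close> (\<open>pr_opposite\<close>); auxiliary vectors are
  therefore chosen with the opposite sign. The condition m > 2 enters because exchanging y for z
  with x fixed takes three complex directions. A second obstacle is that tangent vectors are
  functionals in an infinite-dimensional space and the curvature at a point is a definite
  description over local fields. The algebra is done in the model space of a chart, linearly
  isomorphic to the tangent space, and tensoriality must be proved before the description means
  anything. As vector fields are total functions, indicators of open sets do the work of bump
  functions.\<close>

lemma quadratic_ratio_bounded_above:
  fixes A B C a b c e :: real
  assumes ab: "a * b < 0" and e: "e \<noteq> 0"
    and bound: "\<And>t. a + b * t\<^sup>2 \<noteq> 0 \<Longrightarrow> (A + B * t + C * t\<^sup>2) / (e * (a + b * t\<^sup>2)) \<le> c"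
  shows "A / a = C / b" and "B = 0"
proof -
  define h where "h = (\<lambda>t::real. e * (a + b * t\<^sup>2))"
  define Q where "Q = (\<lambda>t. A + B * t + C * t\<^sup>2 - c * h t)"
  have a0: "a \<noteq> 0" and b0: "b \<noteq> 0" using ab by auto
  \<comment> \<open>Multiplying the bound by the square of the denominator clears it whatever its
    sign.\<close>
  have hQ: "h t * Q t \<le> 0" for t
  proof (cases "a + b * t\<^sup>2 = 0")
    case False
    then have h0: "h t \<noteq> 0" using e by (simp add: h_def)
    have "(A + B * t + C * t\<^sup>2) / h t \<le> c" using bound[OF False] by (simp add: h_def)
    then have "(h t * h t) * ((A + B * t + C * t\<^sup>2) / h t) \<le> (h t * h t) * c"
      by (rule mult_left_mono) simp
    moreover have "(h t * h t) * ((A + B * t + C * t\<^sup>2) / h t) = h t * (A + B * t + C * t\<^sup>2)"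
      using h0 by simp
    ultimately show ?thesis by (simp add: Q_def right_diff_distrib mult.commute mult.left_commute)
  qed (simp add: h_def)
  \<comment> \<open>If \<open>Q r\<close> were nonzero, \<open>Q\<close> would keep its sign near r,
    while \<open>h\<close> changes sign at the simple root r; the product could not stay
    nonpositive.\<close>
  have zero: "Q r = 0" if r: "a + b * r\<^sup>2 = 0" for r
  proof (rule ccontr)
    assume Qr: "Q r \<noteq> 0"
    have r0: "r \<noteq> 0" using r a0 by auto
    have "isCont (\<lambda>t. Q t * Q r) r"
      unfolding Q_def h_def by (intro continuous_intros)
    then have "((\<lambda>t. Q t * Q r) \<longlongrightarrow> Q r * Q r) (at r)" by (simp add: isCont_def)
    moreover have "0 < Q r * Q r" using Qr by (auto simp: zero_less_mult_iff)
    ultimately have "eventually (\<lambda>t. 0 < Q t * Q r) (at r)"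
      by (rule order_tendstoD(1))
    then obtain d where d: "d > 0" "\<And>t. t \<noteq> r \<Longrightarrow> dist t r < d \<Longrightarrow> 0 < Q t * Q r"
      unfolding eventually_at by blast
    \<comment> \<open>Halving d keeps both test points inside the neighbourhood; \<epsilon> \<le>
      abs r < 2 * abs r gives the factors \<epsilon> + 2r and \<epsilon> - 2r of \<open>h\<close>
      opposite signs.\<close>
    define \<epsilon> where "\<epsilon> = min (d / 2) (\<bar>r\<bar>)"
    have eps: "\<epsilon> > 0" "\<epsilon> < d" "\<epsilon> \<le> \<bar>r\<bar>" using d r0 by (auto simp: \<epsilon>_def)
    have p: "0 < Q (r + \<epsilon>) * Q r" "0 < Q (r - \<epsilon>) * Q r"
      using d(2)[of "r + \<epsilon>"] d(2)[of "r - \<epsilon>"] eps by (auto simp: dist_real_def)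
    have he: "h (r + \<epsilon>) = (e * b * \<epsilon>) * (\<epsilon> + 2 * r)" "h (r - \<epsilon>) = (e * b * \<epsilon>) * (\<epsilon> - 2 * r)"
    proof -
      have a: "a = - b * r\<^sup>2" using r by simp
      show "h (r + \<epsilon>) = (e * b * \<epsilon>) * (\<epsilon> + 2 * r)" "h (r - \<epsilon>) = (e * b * \<epsilon>) * (\<epsilon> - 2 * r)"
        unfolding h_def a by (simp_all add: power2_eq_square algebra_simps)
    qed
    have "(\<epsilon> + 2 * r) * (\<epsilon> - 2 * r) < 0"
    proof (cases "r > 0")
      case True then show ?thesis using eps by (intro mult_pos_neg) auto
    next
      case False then show ?thesis using eps r0 by (intro mult_neg_pos) auto
    qed
    moreover have "(e * b * \<epsilon>)\<^sup>2 > 0" using e b0 eps by simp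
    ultimately have "(e * b * \<epsilon>)\<^sup>2 * ((\<epsilon> + 2 * r) * (\<epsilon> - 2 * r)) < 0"
      by (rule mult_pos_neg[rotated])
    then have hh: "h (r + \<epsilon>) * h (r - \<epsilon>) < 0"
      unfolding he by (simp only: power2_eq_square mult.assoc mult.left_commute)
    have QQ: "0 < Q (r + \<epsilon>) * Q (r - \<epsilon>)"
      using p by (auto simp: zero_less_mult_iff)
    have "0 \<le> (h (r + \<epsilon>) * Q (r + \<epsilon>)) * (h (r - \<epsilon>) * Q (r - \<epsilon>))"
      using hQ by (intro mult_nonpos_nonpos)
    also have "\<dots> = (h (r + \<epsilon>) * h (r - \<epsilon>)) * (Q (r + \<epsilon>) * Q (r - \<epsilon>))" by simp
    also have "\<dots> < 0" using hh QQ by (rule mult_neg_pos)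
    finally show False by simp
  qed
  \<comment> \<open>Opposite signs of a and b make both roots real. There the term c * h drops out
    of \<open>Q\<close>, and the difference of the two equations isolates B.\<close>
  define \<tau> where "\<tau> = sqrt (- a / b)"
  have "a / b < 0" using ab by (simp only: divide_less_0_iff mult_less_0_iff)
  then have "- a / b > 0" by simp
  then have tau: "\<tau> > 0" "\<tau>\<^sup>2 = - a / b" by (auto simp: \<tau>_def)
  have r1: "a + b * \<tau>\<^sup>2 = 0" "a + b * (- \<tau>)\<^sup>2 = 0" using tau b0 by auto
  have "h \<tau> = 0" "h (- \<tau>) = 0" using r1 by (auto simp: h_def)
  then have q: "A + B * \<tau> + C * \<tau>\<^sup>2 = 0" "A - B * \<tau> + C * \<tau>\<^sup>2 = 0"
    using zero[OF r1(1)] zero[OF r1(2)] by (auto simp: Q_def)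
  then have "B * \<tau> = 0" by linarith
  then show "B = 0" using tau by simp
  then have "A + C * (- a / b) = 0" using q tau by simp
  then show "A / a = C / b" using a0 b0 by (simp add: field_simps)
qed

section \<open>Hermitian forms and curvature-like tensors on a vector space\<close>

locale hermitian_curvature =
  fixes G :: "'v::euclidean_space \<Rightarrow> 'v \<Rightarrow> real"
    and j :: "'v \<Rightarrow> 'v"
    and R :: "'v \<Rightarrow> 'v \<Rightarrow> 'v \<Rightarrow> 'v \<Rightarrow> real"
  assumes G_linear: "linear (\<lambda>x. G x y)"
    and G_sym: "G x y = G y x"
    and G_nondeg: "(\<And>y. G x y = 0) \<Longrightarrow> x = 0"
    and j_linear: "linear j"
    and j_j: "j (j x) = - x"
    and G_j: "G (j x) (j y) = G x y"
    and R_linear1: "linear (\<lambda>x. R x y z u)"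
    and R_linear3: "linear (\<lambda>z. R x y z u)"
    and R_skew12: "R x y z u = - R y x z u"
    and R_skew34: "R x y z u = - R x y u z"
begin

lemma G_simps [simp]:
  "G (x + y) z = G x z + G y z" "G (x - y) z = G x z - G y z" "G (r *\<^sub>R x) z = r * G x z"
  "G (- x) z = - G x z" "G 0 z = 0"
  "G z (x + y) = G z x + G z y" "G z (x - y) = G z x - G z y" "G z (r *\<^sub>R x) = r * G z x"
  "G z (- x) = - G z x" "G z 0 = 0"
proof -
  note l = linear_add[OF G_linear] linear_diff[OF G_linear] linear_scale[OF G_linear]
    linear_neg[OF G_linear] linear_0[OF G_linear]
  show "G (x + y) z = G x z + G y z" "G (x - y) z = G x z - G y z" "G (r *\<^sub>R x) z = r * G x z"
    "G (- x) z = - G x z" "G 0 z = 0"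
    by (simp_all add: l)
  then show "G z (x + y) = G z x + G z y" "G z (x - y) = G z x - G z y" "G z (r *\<^sub>R x) = r * G z x"
    "G z (- x) = - G z x" "G z 0 = 0"
    by (simp_all add: G_sym[of z] l)
qed

lemma j_simps [simp]:
  "j (x + y) = j x + j y" "j (x - y) = j x - j y" "j (r *\<^sub>R x) = r *\<^sub>R j x" "j (- x) = - j x"
  "j 0 = 0" "j (j x) = - x"
  by (simp_all add: linear_add[OF j_linear] linear_diff[OF j_linear] linear_scale[OF j_linear]
      linear_neg[OF j_linear] linear_0[OF j_linear] j_j)

lemma G_j_skew: "G (j x) y = - G x (j y)"
  using G_j[of "j x" y] G_j[of x "j y"] by simp

lemma G_x_jx [simp]: "G x (j x) = 0" "G (j x) x = 0"
  using G_j_skew[of x x] G_sym[of "j x" x] by auto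

lemma R_simps:
  "R (x + y) z u v = R x z u v + R y z u v" "R (r *\<^sub>R x) z u v = r * R x z u v"
  "R x (y + z) u v = R x y u v + R x z u v" "R x (r *\<^sub>R y) u v = r * R x y u v"
  "R x y (z + u) v = R x y z v + R x y u v" "R x y (r *\<^sub>R z) u = r * R x y z u"
  "R x y z (u + v) = R x y z u + R x y z v" "R x y z (r *\<^sub>R u) = r * R x y z u"
proof -
  note l = linear_add[OF R_linear1] linear_scale[OF R_linear1]
    linear_add[OF R_linear3] linear_scale[OF R_linear3]
  show "R (x + y) z u v = R x z u v + R y z u v" "R (r *\<^sub>R x) z u v = r * R x z u v"
    "R x y (z + u) v = R x y z v + R x y u v" "R x y (r *\<^sub>R z) u = r * R x y z u"
    by (simp_all add: l)
  show "R x (y + z) u v = R x y u v + R x z u v" "R x (r *\<^sub>R y) u v = r * R x y u v"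
    by (simp_all add: R_skew12[of x] l)
  show "R x y z (u + v) = R x y z u + R x y z v" "R x y z (r *\<^sub>R u) = r * R x y z u"
    by (simp_all add: R_skew34[of x y z] l)
qed

lemma R_diag [simp]: "R x x z u = 0" "R x y z z = 0"
  using R_skew12[of x x z u] R_skew34[of x y z z] by auto

text \<open>Two skew symmetries cost two signs. This makes \<kappa> symmetric, so that the first
  vector can be exchanged as well as the second.\<close>

lemma R_swap: "R x y y x = R y x x y"
  using R_skew12[of x y y x] R_skew34[of y x y x] by simp

definition gram :: "'v \<Rightarrow> 'v \<Rightarrow> real" where "gram x y = G x x * G y y - (G x y)\<^sup>2"

text \<open>Here and in \<open>R_change_basis\<close> the factor is the squared determinant of the
  change of basis, so the quotient depends on the plane alone.\<close>

lemma gram_change_basis: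
  "gram (a *\<^sub>R x + b *\<^sub>R y) (c *\<^sub>R x + d *\<^sub>R y) = (a * d - b * c)\<^sup>2 * gram x y"
proof -
  have eq: "(a * (a * p + b * q) + b * (a * q + b * r)) * (c * (c * p + d * q) + d * (c * q + d * r)) -
      (c * (a * p + b * q) + d * (a * q + b * r))\<^sup>2 = (a * d - b * c)\<^sup>2 * (p * r - q\<^sup>2)" for p q r :: real
    by algebra
  show ?thesis by (simp add: gram_def G_sym[of y x] eq)
qed

lemma R_change_basis:
  "R (a *\<^sub>R x + b *\<^sub>R y) (c *\<^sub>R x + d *\<^sub>R y) (c *\<^sub>R x + d *\<^sub>R y) (a *\<^sub>R x + b *\<^sub>R y)
    = (a * d - b * c)\<^sup>2 * R x y y x"
proof -
  have skew: "R y x y x = - R x y y x" "R x y x y = - R x y y x" "R y x x y = R x y y x"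
    using R_skew12[of y x y x] R_skew34[of x y x y] R_swap[of x y] by auto
  show ?thesis by (simp add: R_simps skew) algebra
qed

text \<open>Orthogonality over the complex numbers; nonnull vectors related by it span a nondegenerate
  antiholomorphic plane, whose sectional curvature is \<open>\<kappa>\<close>.\<close>

definition hor :: "'v \<Rightarrow> 'v \<Rightarrow> bool" where "hor x y \<longleftrightarrow> G x y = 0 \<and> G x (j y) = 0"

definition \<kappa> :: "'v \<Rightarrow> 'v \<Rightarrow> real" where "\<kappa> x y = R x y y x / (G x x * G y y)"

lemma \<kappa>_sym: "\<kappa> x y = \<kappa> y x"
  unfolding \<kappa>_def by (simp add: R_swap[of x y])

lemma hor_sym: "hor x y \<Longrightarrow> hor y x"
  unfolding hor_def using G_j_skew[of x y] G_sym by (metis neg_equal_0_iff_equal)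

lemma hor_add: "hor x y \<Longrightarrow> hor x z \<Longrightarrow> hor x (y + z)"
  and hor_scale: "hor x y \<Longrightarrow> hor x (r *\<^sub>R y)"
  and hor_diff: "hor x y \<Longrightarrow> hor x z \<Longrightarrow> hor x (y - z)"
  and hor_j: "hor x y \<Longrightarrow> hor x (j y)"
  by (auto simp: hor_def)

lemmas hor_intros = hor_add hor_scale hor_diff hor_j

text \<open>For nonnull \<open>x\<close>, the projection along its complex line: \<open>x\<close>
  and \<open>j x\<close> are orthogonal and have the same square, hence the common
  denominator.\<close>

definition pr :: "'v \<Rightarrow> 'v \<Rightarrow> 'v" where
  "pr x v = v - ((G v x / G x x) *\<^sub>R x + (G v (j x) / G x x) *\<^sub>R j x)"

lemma pr_hor: "G x x \<noteq> 0 \<Longrightarrow> hor x (pr x v)"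
  using G_sym[of v x] G_j_skew[of x v] G_sym[of "j x" v] by (simp add: hor_def pr_def)

lemma pr_hor_other: "hor y x \<Longrightarrow> hor y v \<Longrightarrow> hor y (pr x v)"
  unfolding pr_def by (intro hor_intros)

lemma G_pr_pr:
  "G x x \<noteq> 0 \<Longrightarrow> G (pr x v) (pr x v) = G v v - ((G v x)\<^sup>2 + (G v (j x))\<^sup>2) / G x x"
  unfolding pr_def
  by (simp add: G_j G_sym[of x v] G_sym[of "j x" v] power2_eq_square add_divide_distrib)

lemma G_pr_right: "hor x w \<Longrightarrow> G w (pr x v) = G w v"
  using hor_sym[of x w] by (simp add: hor_def pr_def)

text \<open>After multiplication by \<open>G x x\<close> the correction in \<open>G_pr_pr\<close> is
  minus a sum of two squares, so it can only strengthen a negative sign. A vector of the same sign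
  as \<open>x\<close> has no such guarantee.\<close>

lemma pr_opposite: "G x x * G v v < 0 \<Longrightarrow> G x x * G (pr x v) (pr x v) < 0"
proof -
  assume a: "G x x * G v v < 0"
  then have x: "G x x \<noteq> 0" by auto
  have "G x x * G (pr x v) (pr x v) = G x x * G v v - ((G v x)\<^sup>2 + (G v (j x))\<^sup>2)"
    using x by (simp add: G_pr_pr right_diff_distrib)
  then show ?thesis using a by (smt (verit) zero_le_power2)
qed

lemma hor_comb:
  assumes "hor x y"
  shows "G (a *\<^sub>R x + b *\<^sub>R y) x = a * G x x" "G (a *\<^sub>R x + b *\<^sub>R y) y = b * G y y"
    "G (a *\<^sub>R x + b *\<^sub>R y) (j (c *\<^sub>R x + d *\<^sub>R y)) = 0"
  using assms hor_sym[OF assms] by (auto simp: hor_def)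

text \<open>Gram-Schmidt needs a nonnull first vector. If both generators are null, nondegeneracy
  forces \<open>G x0 y0\<close> to be nonzero, and \<open>x0 + y0\<close> serves.\<close>

lemma orthogonal_basis:
  assumes nondeg: "\<And>u. u \<in> span {x0, y0} \<Longrightarrow> (\<And>v. v \<in> span {x0, y0} \<Longrightarrow> G u v = 0) \<Longrightarrow> u = 0"
    and plane: "\<And>x. \<not> {x0, y0} \<subseteq> span {x}"
  obtains x y where "span {x, y} = span {x0, y0}" "G x x \<noteq> 0" "G y y \<noteq> 0" "G x y = 0"
proof -
  have sp: "x0 \<in> span {x0, y0}" "y0 \<in> span {x0, y0}" by (auto intro: span_base)
  obtain x y1 where x: "span {x, y1} = span {x0, y0}" "G x x \<noteq> 0"
  proof (cases "G x0 x0 = 0 \<and> G y0 y0 = 0")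
    case False
    then show ?thesis using that[of x0 y0] that[of y0 x0] by (auto simp: insert_commute)
  next
    case True
    have "x0 \<noteq> 0" using plane[of y0] by (auto intro: span_base span_zero)
    have "G x0 y0 \<noteq> 0"
    proof
      assume 0: "G x0 y0 = 0"
      have "G x0 v = 0" if "v \<in> span {x0, y0}" for v
        using that True 0 by (auto simp: span_insert span_singleton algebra_simps dest!: eq_diff_eq[THEN iffD1])
      then show False using nondeg[OF sp(1)] \<open>x0 \<noteq> 0\<close> by blast
    qed
    then have "G (x0 + y0) (x0 + y0) \<noteq> 0" using True by (simp add: G_sym[of y0 x0])
    moreover have "span {x0 + y0, y0} = span {x0, y0}"
    proof -
      have "x0 \<in> span {x0 + y0, y0}"
        using span_diff[of "x0 + y0" "{x0 + y0, y0}" y0] by (simp add: span_base)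
      then show ?thesis unfolding span_eq using sp by (auto intro: span_base span_add)
    qed
    ultimately show ?thesis using that by blast
  qed
  define y where "y = y1 - (G x y1 / G x x) *\<^sub>R x"
  have xy: "G x y = 0" using x by (simp add: y_def)
  have y1: "y1 = y + (G x y1 / G x x) *\<^sub>R x" by (simp add: y_def)
  have span: "span {x, y} = span {x0, y0}"
  proof -
    have "y \<in> span {x, y1}" unfolding y_def by (intro span_diff span_scale span_base) auto
    moreover have "y1 \<in> span {x, y}" by (subst y1) (intro span_add span_scale span_base; simp)
    ultimately have "span {x, y} = span {x, y1}" unfolding span_eq by (auto intro: span_base)
    then show ?thesis using x by simp
  qed
  \<comment> \<open>A null \<open>y\<close> would be orthogonal to the whole plane, hence 0, and the
    plane would collapse to a line.\<close>
  have "G y y \<noteq> 0"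
  proof
    assume yy: "G y y = 0"
    have "G y v = 0" if "v \<in> span {x0, y0}" for v
    proof -
      have "v \<in> span {x, y}" using that span by simp
      then obtain a b where "v = a *\<^sub>R x + b *\<^sub>R y"
        by (auto simp: span_insert span_singleton algebra_simps dest!: eq_diff_eq[THEN iffD1])
      then show ?thesis using yy xy by (simp add: G_sym[of y x])
    qed
    moreover have "y \<in> span {x0, y0}" using span span_base[of y "{x, y}"] by simp
    ultimately have "y = 0" using nondeg by blast
    then have "span {x0, y0} = span {x}" using span span_insert_0[of "{x}"] by (simp add: insert_commute)
    then show False using plane[of x] sp by auto
  qed
  then show ?thesis using that span x xy by blast
qed

end

section \<open>Exchange of vectors under an upper curvature bound\<close>

locale bounded_antiholomorphic_curvature = hermitian_curvature G j R
  for G :: "'v::euclidean_space \<Rightarrow> 'v \<Rightarrow> real" and j R +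
  assumes dim_gt: "DIM('v) > 4"
    and ex_neg: "\<exists>n. G n n < 0" and ex_pos: "\<exists>n. G n n > 0"
    and bounded: "\<exists>c. \<forall>x y. hor x y \<longrightarrow> G x x \<noteq> 0 \<longrightarrow> G y y \<noteq> 0 \<longrightarrow> \<kappa> x y \<le> c"
begin

lemma ex_opposite: "G x x \<noteq> 0 \<Longrightarrow> \<exists>n. G x x * G n n < 0"
  using ex_neg ex_pos by (metis linorder_neqE_linordered_idom mult_neg_pos mult_pos_neg)

text \<open>Successive projection along x, y and z. As these share one sign,
  \<open>pr_opposite\<close> applies at each step, and their mutual orthogonality preserves what the
  earlier steps achieved.\<close>

lemma ex_opposite_hor3:
  assumes "G x x * G y y > 0" "G x x * G z z > 0" "hor x y" "hor x z" "hor y z"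
  obtains n where "G x x * G n n < 0" "hor x n" "hor y n" "hor z n"
proof -
  have nz: "G x x \<noteq> 0" "G y y \<noteq> 0" "G z z \<noteq> 0" using assms by auto
  obtain n where n: "G x x * G n n < 0" using ex_opposite nz by blast
  define n1 where "n1 = pr x n"
  define n2 where "n2 = pr y n1"
  define n3 where "n3 = pr z n2"
  have 1: "G x x * G n1 n1 < 0" unfolding n1_def by (rule pr_opposite[OF n])
  then have "G y y * G n1 n1 < 0" using assms(1) by (auto simp: mult_less_0_iff zero_less_mult_iff)
  from pr_opposite[OF this] have 2: "G y y * G n2 n2 < 0" by (simp add: n2_def)
  then have "G z z * G n2 n2 < 0"
    using assms(1,2) by (auto simp: mult_less_0_iff zero_less_mult_iff)
  from pr_opposite[OF this] have 3: "G z z * G n3 n3 < 0" by (simp add: n3_def)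
  then have 4: "G x x * G n3 n3 < 0"
    using assms(2) by (auto simp: mult_less_0_iff zero_less_mult_iff)
  have "hor x n1" "hor x n2" "hor x n3" "hor y n2" "hor y n3" "hor z n3"
    unfolding n1_def n2_def n3_def using nz assms(3-5) by (auto intro!: pr_hor pr_hor_other)
  with 4 show ?thesis using that by blast
qed

text \<open>The complement of two orthogonal nonnull complex lines is nondegenerate: projecting
  \<open>u\<close> into it does not change its product with a \<open>w\<close> already lying
  there.\<close>

lemma ex_pairing_hor2:
  assumes "G x x \<noteq> 0" "G y y \<noteq> 0" "hor x y" "hor x w" "hor y w" "w \<noteq> 0"
  obtains u where "G w u \<noteq> 0" "hor x u" "hor y u"
proof -
  obtain u where u: "G w u \<noteq> 0" using G_nondeg \<open>w \<noteq> 0\<close> by blast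
  have "G w (pr y (pr x u)) = G w u" using assms by (simp add: G_pr_right)
  moreover have "hor x (pr y (pr x u))" "hor y (pr y (pr x u))"
    using assms by (auto intro!: pr_hor pr_hor_other)
  ultimately show ?thesis using u that by metis
qed

text \<open>This is where the dimension counts: two complex lines span at most 4 real dimensions, so
  their complement contains a nonzero, possibly null, vector \<open>w\<close>.\<close>

lemma ex_nonnull_hor2:
  assumes "G x x \<noteq> 0" "G y y \<noteq> 0" "hor x y"
  obtains z where "G z z \<noteq> 0" "hor x z" "hor y z"
proof -
  let ?B = "{x, j x, y, j y}"
  have "card ?B \<le> 4" by (simp add: card_insert_if)
  then have "dim (span ?B) < DIM('v)"
    using dim_le_card'[of ?B] dim_gt by simp
  then have "span ?B \<noteq> UNIV" by (metis dim_UNIV less_irrefl)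
  then obtain v where v: "v \<notin> span ?B" by auto
  define w where "w = pr y (pr x v)"
  have w: "hor x w" "hor y w" unfolding w_def using assms by (auto intro!: pr_hor pr_hor_other)
  have "w \<noteq> 0"
  proof
    assume "w = 0"
    then have "v = ((G v x / G x x) *\<^sub>R x + (G v (j x) / G x x) *\<^sub>R j x) +
      ((G (pr x v) y / G y y) *\<^sub>R y + (G (pr x v) (j y) / G y y) *\<^sub>R j y)"
      unfolding w_def pr_def[of y] unfolding pr_def[of x v] by (simp add: algebra_simps)
    also have "\<dots> \<in> span ?B" by (intro span_add span_scale span_base) auto
    finally show False using v by simp
  qed
  then obtain u where u: "G w u \<noteq> 0" "hor x u" "hor y u"
    using ex_pairing_hor2[OF assms w] by blast
  \<comment> \<open>Polarisation: w, u and w + u cannot all be null when \<open>G w u\<close> is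
    nonzero.\<close>
  have "G (w + u) (w + u) = G w w + 2 * G w u + G u u" by (simp add: G_sym[of u w])
  then have "G w w \<noteq> 0 \<or> G u u \<noteq> 0 \<or> G (w + u) (w + u) \<noteq> 0" using u(1) by auto
  then show ?thesis using that u w hor_add by metis
qed

text \<open>The sum in the second claim is the coefficient of t in
  \<open>R x (y + t *\<^sub>R z) (y + t *\<^sub>R z) x\<close>. Its two summands are kept together,
  since their equality would need the pair symmetry of \<open>R\<close>.\<close>

lemma opposite_pair:
  assumes "hor x y" "hor x z" "hor y z" "G x x \<noteq> 0" "G y y * G z z < 0"
  shows "\<kappa> x y = \<kappa> x z" and "R x y z x + R x z y x = 0"
proof -
  obtain c where c: "\<And>x y. hor x y \<Longrightarrow> G x x \<noteq> 0 \<Longrightarrow> G y y \<noteq> 0 \<Longrightarrow> \<kappa> x y \<le> c"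
    using bounded by blast
  have yz: "G y z = 0" "G z y = 0" using assms(3) hor_sym[OF assms(3)] by (auto simp: hor_def)
  have bound: "(R x y y x + (R x y z x + R x z y x) * t + R x z z x * t\<^sup>2) /
      (G x x * (G y y + G z z * t\<^sup>2)) \<le> c" if "G y y + G z z * t\<^sup>2 \<noteq> 0" for t
  proof -
    have g: "G (y + t *\<^sub>R z) (y + t *\<^sub>R z) = G y y + G z z * t\<^sup>2"
      by (simp add: yz power2_eq_square)
    have "R x (y + t *\<^sub>R z) (y + t *\<^sub>R z) x = R x y y x + (R x y z x + R x z y x) * t + R x z z x * t\<^sup>2"
      by (simp add: R_simps power2_eq_square algebra_simps)
    moreover have "\<kappa> x (y + t *\<^sub>R z) \<le> c"
      using assms that by (intro c hor_intros) (simp_all only: g not_False_eq_True)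
    ultimately show ?thesis by (simp only: \<kappa>_def g)
  qed
  note q = quadratic_ratio_bounded_above[OF assms(5,4) bound]
  show "R x y z x + R x z y x = 0" by (rule q(2))
  have "R x y y x / G y y / G x x = R x z z x / G z z / G x x" using q(1) by simp
  then show "\<kappa> x y = \<kappa> x z" by (simp add: \<kappa>_def mult.commute)
qed

lemma \<kappa>_triple:
  assumes "hor x y" "hor x z" "hor y z" "G x x \<noteq> 0" "G y y \<noteq> 0" "G z z \<noteq> 0"
  shows "\<kappa> x y = \<kappa> x z"
proof (cases "G y y * G z z < 0")
  case True
  then show ?thesis using opposite_pair assms by blast
next
  case False
  then have yz: "G y y * G z z > 0" using assms(5,6) by (auto simp: mult_less_0_iff zero_less_mult_iff)
  show ?thesis
  proof (cases "G x x * G y y < 0")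
    case True
    then have xz: "G x x * G z z < 0" using yz by (auto simp: mult_less_0_iff zero_less_mult_iff)
    \<comment> \<open>Here x is opposite to both y and z, so y and then z take the role of the fixed
      vector.\<close>
    have "\<kappa> x y = \<kappa> y x" by (rule \<kappa>_sym)
    also have "\<dots> = \<kappa> y z" using assms hor_sym xz by (intro opposite_pair) auto
    also have "\<dots> = \<kappa> z y" by (rule \<kappa>_sym)
    also have "\<dots> = \<kappa> z x" using assms hor_sym True
      by (intro opposite_pair) (auto simp: mult.commute)
    finally show ?thesis by (simp add: \<kappa>_sym)
  next
    case False
    then have xy: "G x x * G y y > 0" using assms(4,5) by (auto simp: mult_less_0_iff zero_less_mult_iff)
    then have xz: "G x x * G z z > 0" using yz by (auto simp: zero_less_mult_iff)
    \<comment> \<open>With three equal signs, y and z are both compared with a fourth vector of the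
      opposite sign.\<close>
    obtain n where n: "G x x * G n n < 0" "hor x n" "hor y n" "hor z n"
      using ex_opposite_hor3[OF xy xz assms(1-3)] by blast
    then have "G y y * G n n < 0" "G z z * G n n < 0"
      using xy xz by (auto simp: mult_less_0_iff zero_less_mult_iff)
    then have "\<kappa> x y = \<kappa> x n" "\<kappa> x z = \<kappa> x n"
      using assms n by (auto intro!: opposite_pair(1))
    then show ?thesis by simp
  qed
qed

lemma mixed_term_triple:
  assumes "hor x y" "hor x z" "hor y z" "G x x \<noteq> 0" "G y y \<noteq> 0" "G z z \<noteq> 0"
  shows "R x y z x + R x z y x = 0"
proof (cases "G y y * G z z < 0")
  case True
  then show ?thesis using opposite_pair assms by blast
next
  case False
  define a b e k S where "a = G y y" and "b = G z z" and "e = G x x" and "k = \<kappa> x y"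
    and "S = R x y z x + R x z y x"
  have pos: "a * b > 0" using False assms(5,6)
    by (auto simp: a_def b_def mult_less_0_iff zero_less_mult_iff)
  \<comment> \<open>Equal signs of y and z keep \<open>y + z\<close> nonnull.\<close>
  then have s: "a + b \<noteq> 0" "a \<noteq> 0" "b \<noteq> 0" "a * b \<noteq> 0" by (auto simp: zero_less_mult_iff)
  have e: "e \<noteq> 0" using assms by (simp add: e_def)
  have yz: "G y z = 0" "G z y = 0" "G y (j z) = 0" "G z (j y) = 0"
    using assms(3) hor_sym[OF assms(3)] by (auto simp: hor_def)
  have R1: "R x y y x = k * e * a" using s e by (simp add: k_def \<kappa>_def e_def a_def)
  have "k = \<kappa> x z" unfolding k_def by (rule \<kappa>_triple[OF assms])
  then have R2: "R x z z x = k * e * b" using s e by (simp add: \<kappa>_def e_def b_def)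
  \<comment> \<open>The pair \<open>y'\<close>, \<open>z'\<close> is orthogonal as well, and the mixed term enters \<open>\<kappa> x y'\<close> and \<open>\<kappa> x z'\<close>
    with opposite signs.\<close>
  define y' z' where "y' = y + z" and "z' = b *\<^sub>R y - a *\<^sub>R z"
  have zz: "z' = b *\<^sub>R y + (- a) *\<^sub>R z" by (simp add: z'_def)
  have g: "G y' y' = a + b" "G z' z' = a * b * (a + b)"
    by (simp_all add: y'_def z'_def yz a_def[symmetric] b_def[symmetric] algebra_simps)
  have "\<kappa> x y' = \<kappa> x z'"
  proof (rule \<kappa>_triple)
    show "hor x y'" "hor x z'" unfolding y'_def z'_def using assms by (intro hor_intros; simp)+
    show "hor y' z'" unfolding hor_def y'_def z'_def
      by (simp add: yz a_def[symmetric] b_def[symmetric])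
    show "G x x \<noteq> 0" by fact
    show "G y' y' \<noteq> 0" "G z' z' \<noteq> 0" using s by (simp_all add: g)
  qed
  moreover have "R x y' y' x = k * e * (a + b) + S"
    by (simp add: y'_def R_simps R1 R2 S_def algebra_simps)
  moreover have "R x z' z' x = a * b * (k * e * (a + b) - S)"
    unfolding zz by (simp only: R_simps R1 R2 S_def) (simp add: algebra_simps)
  ultimately have "(k * e * (a + b) + S) / (e * (a + b)) = a * b * (k * e * (a + b) - S) / (e * (a * b * (a + b)))"
    by (simp add: \<kappa>_def g e_def)
  also have "\<dots> = (k * e * (a + b) - S) / (e * (a + b))"
    using mult_divide_mult_cancel_left[OF s(4), of "k * e * (a + b) - S" "e * (a + b)"]
    by (simp only: mult.left_commute[of e])
  finally have "k * e * (a + b) + S = k * e * (a + b) - S" using s e by simp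
  then show ?thesis by (simp add: S_def)
qed

text \<open>Split y' into a part \<open>y1\<close> in the complex line of y and a part
  \<open>w\<close> in its complement. With the mixed term gone, the numerator and the Gram
  determinant are both additive over this splitting, with the same ratio on each part.\<close>

lemma \<kappa>_eq_of_nonnull_pr:
  assumes "hor x y" "hor x y'" "G x x \<noteq> 0" "G y y \<noteq> 0" "G y' y' \<noteq> 0"
    and w: "G (pr y y') (pr y y') \<noteq> 0"
  shows "\<kappa> x y = \<kappa> x y'"
proof -
  define w a b y1 where "w = pr y y'" and "a = G y' y / G y y" and "b = G y' (j y) / G y y"
    and "y1 = a *\<^sub>R y + b *\<^sub>R j y"
  have y': "y' = y1 + w" by (simp add: y1_def w_def pr_def a_def b_def)
  have hw: "hor x w" "hor y w" unfolding w_def using assms by (auto intro: pr_hor pr_hor_other)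
  have w0: "G w w \<noteq> 0" using w by (simp add: w_def)
  have xw: "\<kappa> x y = \<kappa> x w" using assms hw w0 by (intro \<kappa>_triple) auto
  \<comment> \<open>On the complex line of a nonnull vector the form is definite, so
    \<open>y1\<close> is either 0 or nonnull.\<close>
  have g1: "G y1 y1 = (a\<^sup>2 + b\<^sup>2) * G y y"
    by (simp add: y1_def G_j power2_eq_square algebra_simps)
  show ?thesis
  proof (cases "a\<^sup>2 + b\<^sup>2 = 0")
    case True
    then have "y1 = 0" by (simp add: y1_def sum_power2_eq_zero_iff)
    then show ?thesis using xw y' by simp
  next
    case False
    then have n1: "G y1 y1 \<noteq> 0" using g1 assms by simp
    have h1: "hor x y1" unfolding y1_def using assms by (intro hor_intros)
    have "hor w y1" unfolding y1_def using hor_sym[OF hw(2)] by (intro hor_intros)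
    then have h2: "hor y1 w" by (rule hor_sym)
    have k: "\<kappa> x y1 = \<kappa> x w" using assms h1 h2 hw n1 w0 by (intro \<kappa>_triple) auto
    have S: "R x y1 w x + R x w y1 x = 0"
      using assms h1 h2 hw n1 w0 by (intro mixed_term_triple) auto
    have gw: "G y1 w = 0" "G w y1 = 0" using h2 hor_sym[OF h2] by (auto simp: hor_def)
    have \<kappa>_mult: "R x v v x = \<kappa> x v * (G x x * G v v)" if "G v v \<noteq> 0" for v
      using that assms(3) by (simp add: \<kappa>_def)
    have "R x y' y' x = R x y1 y1 x + R x w w x" using S by (simp add: y' R_simps)
    also have "\<dots> = \<kappa> x w * (G x x * G y1 y1) + \<kappa> x w * (G x x * G w w)"
      using \<kappa>_mult[OF n1] \<kappa>_mult[OF w0] k by simp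
    also have "\<dots> = \<kappa> x w * (G x x * G y' y')" by (simp add: y' gw algebra_simps)
    finally have "\<kappa> x y' = \<kappa> x w" using assms by (simp add: \<kappa>_def)
    then show ?thesis using xw by simp
  qed
qed

lemma pr_nonnull_of_opposite:
  assumes "G y y * G y' y' < 0"
  shows "G (pr y y') (pr y y') \<noteq> 0"
  using pr_opposite[OF assms] by auto

text \<open>The projection \<open>w\<close> of y' decides the case: nonnull is settled above, zero
  puts y' into the complex line of y, and a nonzero null \<open>w\<close> requires a detour.\<close>

lemma \<kappa>_depends_on_first:
  assumes "hor x y" "hor x y'" "G x x \<noteq> 0" "G y y \<noteq> 0" "G y' y' \<noteq> 0"
  shows "\<kappa> x y = \<kappa> x y'"
proof -
  define w a b where "w = pr y y'" and "a = G y' y / G y y" and "b = G y' (j y) / G y y"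
  have y': "y' = a *\<^sub>R y + b *\<^sub>R j y + w" by (simp add: w_def pr_def a_def b_def)
  have hw: "hor x w" "hor y w" unfolding w_def using assms by (auto intro: pr_hor pr_hor_other)
  consider "G w w \<noteq> 0" | "w = 0" | "G w w = 0" "w \<noteq> 0" by blast
  then show ?thesis
  proof cases
    case 1
    then show ?thesis using \<kappa>_eq_of_nonnull_pr assms w_def by blast
  next
    case 2
    \<comment> \<open>A third direction is orthogonal to the common complex line of y and y', hence
      exchangeable with either.\<close>
    obtain z where z: "G z z \<noteq> 0" "hor x z" "hor y z"
      using ex_nonnull_hor2[of x y] assms by blast
    have "hor z y'" unfolding y' 2 using hor_sym[OF z(3)] by (simp add: hor_intros)
    then have "hor y' z" by (rule hor_sym)
    then have "\<kappa> x y' = \<kappa> x z" "\<kappa> x y = \<kappa> x z" using z assms by (auto intro!: \<kappa>_triple)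
    then show ?thesis by simp
  next
    case 3
    \<comment> \<open>A nonzero null \<open>w\<close> in the complement of \<open>x\<close> and \<open>y\<close> provides there a vector \<open>n\<close> of sign opposite
      to that of \<open>y\<close> and \<open>y'\<close>, through which the two can be compared.\<close>
    obtain u where u: "G w u \<noteq> 0" "hor x u" "hor y u"
      using ex_pairing_hor2[of x y w] assms hw 3 by blast
    \<comment> \<open>Since \<open>w\<close> is null, the square of u + t w is affine in t; this t
      makes it exactly - G y y.\<close>
    define t where "t = (- G y y - G u u) / (2 * G w u)"
    define n where "n = u + t *\<^sub>R w"
    have "G n n = G u u + t * (2 * G w u)" by (simp add: n_def 3 G_sym[of u w])
    then have n: "G n n = - G y y" using u(1) by (simp add: t_def)
    have hn: "hor x n" unfolding n_def using u hw by (intro hor_intros)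
    have "G w y = 0" "G w (j y) = 0" "G y w = 0" "G (j y) w = 0"
      using hw(2) hor_sym[OF hw(2)] G_sym[of "j y" w] by (auto simp: hor_def)
    \<comment> \<open>The null part contributes nothing to the square, so y' has the sign of
      y.\<close>
    then have gy': "G y' y' = (a\<^sup>2 + b\<^sup>2) * G y y"
      unfolding y' by (simp add: 3 G_j power2_eq_square algebra_simps)
    have sq: "0 < G y y * G y y" using assms(4) not_real_square_gt_zero by blast
    have "a\<^sup>2 + b\<^sup>2 \<noteq> 0" using assms(5) gy' by auto
    then have "0 < (a\<^sup>2 + b\<^sup>2) * (G y y * G y y)"
      by (intro mult_pos_pos[OF _ sq]) (simp add: sum_power2_gt_zero_iff sum_power2_eq_zero_iff)
    then have "G n n * G y' y' < 0" unfolding n gy' by (simp add: mult.left_commute)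
    then have "\<kappa> x n = \<kappa> x y'"
      using assms hn n by (intro \<kappa>_eq_of_nonnull_pr pr_nonnull_of_opposite) auto
    moreover have "G n n * G y y < 0" unfolding n using sq by simp
    then have "\<kappa> x n = \<kappa> x y"
      using assms hn n by (intro \<kappa>_eq_of_nonnull_pr pr_nonnull_of_opposite) auto
    ultimately show ?thesis by simp
  qed
qed

text \<open>Opposite signs make the projection \<open>w\<close> of x' nonnull, so x and
  \<open>w\<close> have a common nonnull orthogonal \<open>u\<close>. It is orthogonal to x' too,
  and the chain runs through the planes of x, u and of u, x'.\<close>

lemma \<kappa>_eq_of_opposite:
  assumes "hor x y" "hor x' y'" "G x x * G x' x' < 0" "G y y \<noteq> 0" "G y' y' \<noteq> 0"
  shows "\<kappa> x y = \<kappa> x' y'"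
proof -
  have nz: "G x x \<noteq> 0" "G x' x' \<noteq> 0" using assms(3) by auto
  define w where "w = pr x x'"
  have w: "hor x w" "G w w \<noteq> 0" unfolding w_def
    using nz pr_nonnull_of_opposite[OF assms(3)] by (auto intro: pr_hor)
  obtain u where u: "G u u \<noteq> 0" "hor x u" "hor w u" using ex_nonnull_hor2 nz w by blast
  have "x' = (G x' x / G x x) *\<^sub>R x + (G x' (j x) / G x x) *\<^sub>R j x + w"
    by (simp add: w_def pr_def)
  then have hu: "hor u x'" using u(2,3) hor_sym by (metis hor_add hor_scale hor_j)
  have "\<kappa> x y = \<kappa> x u" using assms u nz by (intro \<kappa>_depends_on_first)
  also have "\<dots> = \<kappa> u x" by (rule \<kappa>_sym)
  also have "\<dots> = \<kappa> u x'" using u hu nz hor_sym by (intro \<kappa>_depends_on_first) auto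
  also have "\<dots> = \<kappa> x' u" by (rule \<kappa>_sym)
  also have "\<dots> = \<kappa> x' y'" using assms u nz hor_sym[OF hu] by (intro \<kappa>_depends_on_first)
  finally show ?thesis .
qed

theorem \<kappa>_constant:
  "\<exists>k. \<forall>x y. hor x y \<longrightarrow> G x x \<noteq> 0 \<longrightarrow> G y y \<noteq> 0 \<longrightarrow> \<kappa> x y = k"
proof -
  have eq: "\<kappa> x y = \<kappa> x' y'"
    if h: "hor x y" "hor x' y'" and nz: "G x x \<noteq> 0" "G y y \<noteq> 0" "G x' x' \<noteq> 0" "G y' y' \<noteq> 0" for x y x' y'
  proof (cases "G x x * G x' x' < 0")
    case True
    then show ?thesis using \<kappa>_eq_of_opposite h nz by blast
  next
    case False
    \<comment> \<open>Vectors of equal sign are linked through a vector opposite to both; making it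
      orthogonal to x gives it the plane with x as its own.\<close>
    obtain n0 where n0: "G x x * G n0 n0 < 0" using ex_opposite nz by blast
    define n where "n = pr x n0"
    have n: "hor x n" "G x x * G n n < 0" unfolding n_def using nz n0
      by (auto intro: pr_hor pr_opposite)
    then have "G n n * G x' x' < 0" using False nz by (auto simp: mult_less_0_iff zero_less_mult_iff)
    moreover have "hor n x" using n hor_sym by blast
    moreover have "\<kappa> x y = \<kappa> n x"
      using \<kappa>_eq_of_opposite[OF h(1) \<open>hor n x\<close> n(2) nz(2,1)] .
    ultimately show ?thesis using \<kappa>_eq_of_opposite[of n x x' y'] h nz by simp
  qed
  show ?thesis
  proof (cases "\<exists>x y. hor x y \<and> G x x \<noteq> 0 \<and> G y y \<noteq> 0")
    case True
    then show ?thesis using eq by metis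
  qed auto
qed

end

section \<open>Smooth functions and vector fields on a manifold\<close>

lemma scaleR_fun_apply: "(c *\<^sub>R f) x = c *\<^sub>R f x"
  by (simp add: scaleR_fun_def)

section \<open>Calculus of class C^k on open subsets of a Euclidean space\<close>

lemma frechet_derivative_cong_open:
  assumes "open S" "x \<in> S" "\<And>y. y \<in> S \<Longrightarrow> f y = h y" "f differentiable at x"
  shows "h differentiable at x" "frechet_derivative h (at x) = frechet_derivative f (at x)"
proof -
  have "(f has_derivative frechet_derivative f (at x)) (at x)"
    using assms(4) frechet_derivative_works by blast
  then have "(h has_derivative frechet_derivative f (at x)) (at x)"
    using assms by (metis has_derivative_transform_within_open)
  then show "h differentiable at x" "frechet_derivative h (at x) = frechet_derivative f (at x)"
    using differentiable_def frechet_derivative_at by metis+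
qed

lemma Ck_on_cong:
  assumes "open S" "\<And>x. x \<in> S \<Longrightarrow> f x = h x" "Ck_on k S f"
  shows "Ck_on k S h"
  using assms(2,3)
proof (induction k arbitrary: f h)
  case 0
  then show ?case by (metis Ck_on.simps(1) continuous_on_cong)
next
  case (Suc k)
  have d: "f differentiable at x" if "x \<in> S" for x using Suc.prems that by simp
  note c = frechet_derivative_cong_open[OF assms(1) _ Suc.prems(1) d]
  have "Ck_on k S (\<lambda>x. frechet_derivative h (at x) v)" for v
    by (rule Suc.IH[of "\<lambda>x. frechet_derivative f (at x) v"]) (use Suc.prems c in auto)
  then show ?case using c by simp
qed

lemma Ck_on_subset: "T \<subseteq> S \<Longrightarrow> Ck_on k S f \<Longrightarrow> Ck_on k T f"
proof (induction k arbitrary: f)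
  case 0
  then show ?case using continuous_on_subset by auto
next
  case (Suc k)
  then show ?case by (auto intro: Suc.IH)
qed

lemma Ck_on_lower: "Ck_on (Suc k) S f \<Longrightarrow> Ck_on k S f"
proof (induction k arbitrary: f)
  case 0
  then show ?case
    by (simp add: continuous_at_imp_continuous_on differentiable_imp_continuous_within)
qed auto

text \<open>Allows the derivative to be supplied by a formula, such as the product or the chain
  rule, in place of \<open>frechet_derivative\<close>.\<close>

lemma Ck_on_SucI:
  assumes "open S" "\<And>x. x \<in> S \<Longrightarrow> (f has_derivative f' x) (at x)" "\<And>v. Ck_on k S (\<lambda>x. f' x v)"
  shows "Ck_on (Suc k) S f"
proof -
  have "frechet_derivative f (at x) = f' x" if "x \<in> S" for x
    using assms(2)[OF that] frechet_derivative_at by metis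
  then have "Ck_on k S (\<lambda>x. frechet_derivative f (at x) v)" for v
    by (intro Ck_on_cong[OF assms(1) _ assms(3)[of v]]) auto
  then show ?thesis using assms(2) by (auto simp: differentiable_def)
qed

lemma Ck_on_SucD:
  assumes "Ck_on (Suc k) S f" "x \<in> S"
  shows "(f has_derivative frechet_derivative f (at x)) (at x)"
  using assms frechet_derivative_works by auto

lemma Ck_on_const: "open S \<Longrightarrow> Ck_on k S (\<lambda>x. c)"
proof (induction k arbitrary: c)
  case (Suc k)
  then show ?case by (intro Ck_on_SucI[where f' = "\<lambda>_ _. 0"]) auto
qed auto

lemma Ck_on_add:
  assumes "open S"
  shows "Ck_on k S f \<Longrightarrow> Ck_on k S h \<Longrightarrow> Ck_on k S (\<lambda>x. f x + h x)"
proof (induction k arbitrary: f h)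
  case (Suc k)
  show ?case
    by (rule Ck_on_SucI[OF assms has_derivative_add[OF Ck_on_SucD[OF Suc.prems(1)] Ck_on_SucD[OF Suc.prems(2)]]])
      (use Suc in auto)
qed (auto intro: continuous_on_add)

lemma Ck_on_sum:
  assumes "open S" "\<And>i. i \<in> I \<Longrightarrow> Ck_on k S (f i)"
  shows "Ck_on k S (\<lambda>x. \<Sum>i\<in>I. f i x)"
  using assms(2)
  by (induction I rule: infinite_finite_induct) (auto intro: Ck_on_const Ck_on_add assms(1))

lemma Ck_on_mult:
  fixes f h :: "'e::euclidean_space \<Rightarrow> real"
  assumes "open S"
  shows "Ck_on k S f \<Longrightarrow> Ck_on k S h \<Longrightarrow> Ck_on k S (\<lambda>x. f x * h x)"
proof (induction k arbitrary: f h)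
  case (Suc k)
  have l: "Ck_on k S f" "Ck_on k S h" using Suc.prems by (auto intro: Ck_on_lower simp del: Ck_on.simps)
  show ?case
    by (rule Ck_on_SucI[OF assms has_derivative_mult[OF Ck_on_SucD[OF Suc.prems(1)] Ck_on_SucD[OF Suc.prems(2)]]])
      (use Suc l in \<open>auto intro!: Ck_on_add assms\<close>)
qed (auto intro: continuous_on_mult)

lemma Ck_on_bounded_linear:
  assumes "open S" "bounded_linear L"
  shows "Ck_on k S f \<Longrightarrow> Ck_on k S (\<lambda>x. L (f x))"
proof (induction k arbitrary: f)
  case 0
  then show ?case using bounded_linear.continuous_on[OF assms(2)] by auto
next
  case (Suc k)
  show ?case
    by (rule Ck_on_SucI[OF assms(1) bounded_linear.has_derivative[OF assms(2) Ck_on_SucD[OF Suc.prems]]])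
      (use Suc in auto)
qed

text \<open>\<open>Ck_on\<close> controls derivatives in fixed directions only, whereas the chain
  rule has the direction \<open>?h' x v\<close> varying with x. Expanding it in the basis gives a
  sum of products to which the induction applies.\<close>

lemma Ck_on_compose:
  fixes f :: "'b::euclidean_space \<Rightarrow> real" and h :: "'e::euclidean_space \<Rightarrow> 'b"
  assumes "open S" "open T" "h ` S \<subseteq> T"
  shows "Ck_on k S h \<Longrightarrow> Ck_on k T f \<Longrightarrow> Ck_on k S (\<lambda>x. f (h x))"
proof (induction k arbitrary: f)
  case 0
  then show ?case using assms(3) by (auto intro: continuous_on_compose2)
next
  case (Suc k)
  have hT: "h x \<in> T" if "x \<in> S" for x using that assms(3) by auto
  let ?h' = "\<lambda>x. frechet_derivative h (at x)" and ?f' = "\<lambda>y. frechet_derivative f (at y)"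
  show ?case
  proof (rule Ck_on_SucI[OF assms(1)])
    show "((\<lambda>x. f (h x)) has_derivative (\<lambda>v. ?f' (h x) (?h' x v))) (at x)" if "x \<in> S" for x
      using has_derivative_compose[OF Ck_on_SucD[OF Suc.prems(1) that] Ck_on_SucD[OF Suc.prems(2) hT[OF that]]] .
    fix v
    have "Ck_on k S (\<lambda>x. ?f' (h x) b)" for b
      by (rule Suc.IH[OF Ck_on_lower[OF Suc.prems(1)]]) (use Suc.prems(2) in simp)
    moreover have "Ck_on k S (\<lambda>x. ?h' x v \<bullet> b)" for b
      by (rule Ck_on_bounded_linear[OF assms(1) bounded_linear_inner_left]) (use Suc.prems(1) in simp)
    ultimately have *: "Ck_on k S (\<lambda>x. \<Sum>b\<in>Basis. (?h' x v \<bullet> b) * ?f' (h x) b)"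
      by (intro Ck_on_sum[OF assms(1)] Ck_on_mult[OF assms(1)])
    show "Ck_on k S (\<lambda>x. ?f' (h x) (?h' x v))"
    proof (rule Ck_on_cong[OF assms(1) _ *])
      fix x assume "x \<in> S"
      then have "linear (?f' (h x))"
        using Ck_on_SucD[OF Suc.prems(2) hT] has_derivative_linear by blast
      then have "?f' (h x) (\<Sum>b\<in>Basis. (?h' x v \<bullet> b) *\<^sub>R b) = (\<Sum>b\<in>Basis. (?h' x v \<bullet> b) * ?f' (h x) b)"
        by (simp add: linear_sum linear_scale)
      then show "(\<Sum>b\<in>Basis. (?h' x v \<bullet> b) * ?f' (h x) b) = ?f' (h x) (?h' x v)"
        by (simp add: euclidean_representation)
    qed
  qed
qed

lemma smooth_on_deriv: "smooth_on S f \<Longrightarrow> smooth_on S (\<lambda>x. frechet_derivative f (at x) v)"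
  unfolding smooth_on_def by (metis Ck_on.simps(2))

lemma smooth_on_has_derivative:
  "smooth_on S f \<Longrightarrow> x \<in> S \<Longrightarrow> (f has_derivative frechet_derivative f (at x)) (at x)"
  unfolding smooth_on_def using Ck_on_SucD by blast

lemma smooth_on_subset: "T \<subseteq> S \<Longrightarrow> smooth_on S f \<Longrightarrow> smooth_on T f"
  unfolding smooth_on_def using Ck_on_subset by blast

lemma smooth_on_cong:
  "open S \<Longrightarrow> (\<And>x. x \<in> S \<Longrightarrow> f x = h x) \<Longrightarrow> smooth_on S f \<Longrightarrow> smooth_on S h"
  unfolding smooth_on_def using Ck_on_cong by metis

section \<open>Charts and smooth functions\<close>

locale manifold =
  fixes M :: "'a topology" and A :: "('a, 'e::euclidean_space) chart set"
  assumes smooth_manifold: "smooth_manifold M A"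
begin

lemma chart_at:
  assumes "p \<in> topspace M"
  obtains U \<phi> where "(U, \<phi>) \<in> A" "p \<in> U"
proof -
  have "p \<in> (\<Union>(U, \<phi>)\<in>A. U)" using assms smooth_manifold by (simp add: smooth_manifold_def)
  then show ?thesis using that by auto
qed

context
  fixes U \<phi> assumes chart: "(U, \<phi>) \<in> A"
begin

lemma is_chart: "is_chart M (U, \<phi>)"
  using smooth_manifold chart by (auto simp: smooth_manifold_def)

lemma chart_open: "openin M U"
  using is_chart by (simp add: is_chart_def)

lemma chart_subset: "U \<subseteq> topspace M"
  using chart_open openin_subset by blast

lemma chart_inj: "inj_on \<phi> U"
proof -
  have "homeomorphic_map (subtopology M U) (top_of_set (\<phi> ` U)) \<phi>"
    using is_chart by (simp add: is_chart_def)
  from homeomorphic_imp_injective_map[OF this] show ?thesis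
    using chart_subset by (simp add: Int_absorb1)
qed

lemma chart_inv [simp]: "q \<in> U \<Longrightarrow> inv_into U \<phi> (\<phi> q) = q"
  using chart_inj by (rule inv_into_f_f)

lemma open_chart_image: "openin M W \<Longrightarrow> open (\<phi> ` (U \<inter> W))"
proof -
  assume W: "openin M W"
  have h: "homeomorphic_map (subtopology M U) (top_of_set (\<phi> ` U)) \<phi>" "open (\<phi> ` U)"
    using is_chart by (auto simp: is_chart_def)
  have "openin (subtopology M U) (U \<inter> W)"
    using W by (metis inf_commute openin_subtopology)
  then have "openin (top_of_set (\<phi> ` U)) (\<phi> ` (U \<inter> W))"
    using h(1) homeomorphic_imp_open_map open_map_def by blast
  then show ?thesis using h(2) openin_open_trans by blast
qed

lemma smooth_fun_chart: "smooth_fun A W f \<Longrightarrow> smooth_on (\<phi> ` (U \<inter> W)) (f \<circ> inv_into U \<phi>)"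
  using chart by (auto simp: smooth_fun_def)

lemma transition_smooth:
  "(V, \<psi>) \<in> A \<Longrightarrow> smooth_on (\<phi> ` (U \<inter> V)) (\<psi> \<circ> inv_into U \<phi>)"
  using smooth_manifold chart by (auto simp: smooth_manifold_def)

end

lemma smooth_funI:
  "(\<And>U \<phi>. (U, \<phi>) \<in> A \<Longrightarrow> smooth_on (\<phi> ` (U \<inter> W)) (f \<circ> inv_into U \<phi>)) \<Longrightarrow> smooth_fun A W f"
  by (auto simp: smooth_fun_def)

lemma smooth_fun_subset: "V \<subseteq> W \<Longrightarrow> smooth_fun A W f \<Longrightarrow> smooth_fun A V f"
  by (rule smooth_funI, rule smooth_on_subset[OF _ smooth_fun_chart[of _ _ W]]) auto

lemma smooth_fun_cong:
  assumes "openin M W" "\<And>q. q \<in> W \<Longrightarrow> f q = h q" "smooth_fun A W f"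
  shows "smooth_fun A W h"
proof (rule smooth_funI)
  fix U \<phi> assume c: "(U, \<phi>) \<in> A"
  show "smooth_on (\<phi> ` (U \<inter> W)) (h \<circ> inv_into U \<phi>)"
    by (rule smooth_on_cong[OF open_chart_image[OF c assms(1)] _ smooth_fun_chart[OF c assms(3)]])
      (use c assms(2) in auto)
qed

lemma smooth_fun_const: "openin M W \<Longrightarrow> smooth_fun A W (\<lambda>q. c)"
  by (rule smooth_funI) (simp add: comp_def smooth_on_def Ck_on_const open_chart_image)

lemma smooth_fun_add:
  "openin M W \<Longrightarrow> smooth_fun A W f \<Longrightarrow> smooth_fun A W h \<Longrightarrow> smooth_fun A W (\<lambda>q. f q + h q)"
  using smooth_fun_chart
  by (intro smooth_funI) (fastforce simp: comp_def smooth_on_def intro!: Ck_on_add open_chart_image)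

lemma smooth_fun_mult:
  "openin M W \<Longrightarrow> smooth_fun A W f \<Longrightarrow> smooth_fun A W h \<Longrightarrow> smooth_fun A W (\<lambda>q. f q * h q)"
  using smooth_fun_chart
  by (intro smooth_funI) (fastforce simp: comp_def smooth_on_def intro!: Ck_on_mult open_chart_image)

text \<open>Smoothness on the open set \<open>W\<close> sees only the values on \<open>W\<close>,
  where the indicator is 1; it is the substitute for a bump function.\<close>

lemma smooth_fun_indicator:
  assumes "openin M W"
  shows "smooth_fun A W (\<lambda>q. indicat_real W q)"
  by (rule smooth_fun_cong[OF assms _ smooth_fun_const[OF assms, of 1]]) simp

lemma smooth_fun_coordinate:
  assumes "(U, \<phi>) \<in> A"
  shows "smooth_fun A U (\<lambda>q. \<phi> q \<bullet> b)"
proof (rule smooth_funI)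
  fix V \<psi> assume c: "(V, \<psi>) \<in> A"
  have "open (\<psi> ` (V \<inter> U))" using assms c by (intro open_chart_image chart_open)
  then show "smooth_on (\<psi> ` (V \<inter> U)) ((\<lambda>q. \<phi> q \<bullet> b) \<circ> inv_into V \<psi>)"
    using transition_smooth[OF c assms] unfolding smooth_on_def comp_def
    by (auto intro: Ck_on_bounded_linear[OF _ bounded_linear_inner_left])
qed

lemma smooth_near_chart:
  assumes "smooth_near M A p f" "(U, \<phi>) \<in> A" "p \<in> U"
  shows "((f \<circ> inv_into U \<phi>) has_derivative frechet_derivative (f \<circ> inv_into U \<phi>) (at (\<phi> p))) (at (\<phi> p))"
proof -
  obtain W where W: "p \<in> W" "smooth_fun A W f" using assms(1) by (auto simp: smooth_near_def)
  show ?thesis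
    by (rule smooth_on_has_derivative[OF smooth_fun_chart[OF assms(2) W(2)]]) (use W assms in auto)
qed

lemma smooth_nearI: "openin M W \<Longrightarrow> p \<in> W \<Longrightarrow> smooth_fun A W f \<Longrightarrow> smooth_near M A p f"
  by (auto simp: smooth_near_def)

lemma smooth_near_cong:
  assumes "openin M V" "p \<in> V" "\<And>q. q \<in> V \<Longrightarrow> f q = h q" "smooth_near M A p f"
  shows "smooth_near M A p h"
proof -
  obtain W where W: "openin M W" "p \<in> W" "smooth_fun A W f"
    using assms(4) by (auto simp: smooth_near_def)
  have o: "openin M (W \<inter> V)" using W assms by blast
  have "smooth_fun A (W \<inter> V) h"
    by (rule smooth_fun_cong[OF o _ smooth_fun_subset[OF _ W(3)]]) (use assms in auto)
  then show ?thesis using o W assms by (auto intro: smooth_nearI)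
qed

section \<open>Tangent vectors in a chart\<close>

lemma dir_deriv_has_derivative:
  assumes "smooth_near M A p f" "(U, \<phi>) \<in> A" "p \<in> U"
  shows "((f \<circ> inv_into U \<phi>) has_derivative (\<lambda>w. dir_deriv M A p (U, \<phi>) w f)) (at (\<phi> p))"
  using smooth_near_chart[OF assms] assms(1) by (simp add: dir_deriv_def)

lemma dir_deriv_eqI:
  assumes "smooth_near M A p f" "(U, \<phi>) \<in> A" "p \<in> U"
    and "((f \<circ> inv_into U \<phi>) has_derivative D) (at (\<phi> p))"
  shows "dir_deriv M A p (U, \<phi>) w f = D w"
  using has_derivative_unique[OF dir_deriv_has_derivative[OF assms(1-3)] assms(4)] by metis

lemma linear_dir_deriv:
  assumes "(U, \<phi>) \<in> A" "p \<in> U"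
  shows "linear (dir_deriv M A p (U, \<phi>))"
proof -
  have lin: "linear (\<lambda>w. dir_deriv M A p (U, \<phi>) w f)" if "smooth_near M A p f" for f
    using dir_deriv_has_derivative[OF that assms] has_derivative_linear by blast
  \<comment> \<open>The default value 0 off the smooth functions makes linearity an equality of
    total functionals.\<close>
  have 0: "dir_deriv M A p (U, \<phi>) w f = 0" if "\<not> smooth_near M A p f" for f w
    using that by (simp add: dir_deriv_def)
  show ?thesis
  proof (rule linearI)
    show "dir_deriv M A p (U, \<phi>) (x + y) = dir_deriv M A p (U, \<phi>) x + dir_deriv M A p (U, \<phi>) y" for x y
    proof
      fix f show "dir_deriv M A p (U, \<phi>) (x + y) f = (dir_deriv M A p (U, \<phi>) x + dir_deriv M A p (U, \<phi>) y) f"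
        using linear_add[OF lin[of f]] 0[of f] by (cases "smooth_near M A p f") auto
    qed
    show "dir_deriv M A p (U, \<phi>) (r *\<^sub>R x) = r *\<^sub>R dir_deriv M A p (U, \<phi>) x" for r x
    proof
      fix f show "dir_deriv M A p (U, \<phi>) (r *\<^sub>R x) f = (r *\<^sub>R dir_deriv M A p (U, \<phi>) x) f"
        using linear_scale[OF lin[of f]] 0[of f]
        by (cases "smooth_near M A p f") (auto simp: scaleR_fun_apply)
    qed
  qed
qed

lemma dir_deriv_transition:
  assumes c: "(U, \<phi>) \<in> A" "p \<in> U" and c': "(V, \<psi>) \<in> A" "p \<in> V"
  shows "dir_deriv M A p (V, \<psi>) w =
    dir_deriv M A p (U, \<phi>) (frechet_derivative (\<phi> \<circ> inv_into V \<psi>) (at (\<psi> p)) w)"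
proof
  fix f
  let ?\<tau> = "\<phi> \<circ> inv_into V \<psi>"
  show "dir_deriv M A p (V, \<psi>) w f = dir_deriv M A p (U, \<phi>) (frechet_derivative ?\<tau> (at (\<psi> p)) w) f"
  proof (cases "smooth_near M A p f")
    case True
    have \<tau>: "(?\<tau> has_derivative frechet_derivative ?\<tau> (at (\<psi> p))) (at (\<psi> p))"
      by (rule smooth_on_has_derivative[OF transition_smooth[OF c'(1) c(1)]]) (use c c' in auto)
    have \<tau>p: "?\<tau> (\<psi> p) = \<phi> p" using c' by simp
    have "((\<lambda>x. (f \<circ> inv_into U \<phi>) (?\<tau> x)) has_derivative
      (\<lambda>w. dir_deriv M A p (U, \<phi>) (frechet_derivative ?\<tau> (at (\<psi> p)) w) f)) (at (\<psi> p))"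
      by (rule has_derivative_compose[OF \<tau>]) (simp only: \<tau>p dir_deriv_has_derivative[OF True c])
    moreover have "open (\<psi> ` (V \<inter> U))" "\<psi> p \<in> \<psi> ` (V \<inter> U)"
      using c c' by (auto intro: open_chart_image chart_open)
    moreover have "(f \<circ> inv_into U \<phi>) (?\<tau> x) = (f \<circ> inv_into V \<psi>) x" if "x \<in> \<psi> ` (V \<inter> U)" for x
      using that c(1) c'(1) by auto
    ultimately have "((f \<circ> inv_into V \<psi>) has_derivative
      (\<lambda>w. dir_deriv M A p (U, \<phi>) (frechet_derivative ?\<tau> (at (\<psi> p)) w) f)) (at (\<psi> p))"
      by (rule has_derivative_transform_within_open)
    then show ?thesis by (rule dir_deriv_eqI[OF True c'])
  qed (simp add: dir_deriv_def)
qed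

lemma tangentE:
  assumes "v \<in> tangent_space M A p"
  obtains U \<phi> w where "(U, \<phi>) \<in> A" "p \<in> U" "v = dir_deriv M A p (U, \<phi>) w"
  using assms by (auto simp: tangent_space_def)

text \<open>The tangent space is defined through all charts at p; by the chain rule the vectors of
  any other chart already arise from this one.\<close>

lemma tangent_space_chart:
  assumes "(U, \<phi>) \<in> A" "p \<in> U"
  shows "tangent_space M A p = range (dir_deriv M A p (U, \<phi>))"
proof (intro subset_antisym subsetI)
  fix v assume "v \<in> tangent_space M A p"
  then obtain V \<psi> w where c': "(V, \<psi>) \<in> A" "p \<in> V" and v: "v = dir_deriv M A p (V, \<psi>) w"
    by (rule tangentE)
  show "v \<in> range (dir_deriv M A p (U, \<phi>))"
    unfolding v dir_deriv_transition[OF assms c'] by (rule rangeI)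
next
  fix v assume "v \<in> range (dir_deriv M A p (U, \<phi>))"
  then show "v \<in> tangent_space M A p" using assms unfolding tangent_space_def by fastforce
qed

lemma subspace_tangent_space:
  assumes "p \<in> topspace M"
  shows "subspace (tangent_space M A p)"
proof -
  obtain U \<phi> where c: "(U, \<phi>) \<in> A" "p \<in> U" using assms by (rule chart_at)
  then show ?thesis
    using linear_subspace_image[OF linear_dir_deriv subspace_UNIV] by (metis tangent_space_chart)
qed

text \<open>Derivatives depend on germs. If one function is not smooth near p, neither is the other,
  and both get the default value 0.\<close>

lemma tangent_cong:
  assumes "v \<in> tangent_space M A p" "openin M V" "p \<in> V" "\<And>q. q \<in> V \<Longrightarrow> f q = h q"
  shows "v f = v h"
proof -
  obtain U \<phi> w where c: "(U, \<phi>) \<in> A" "p \<in> U" and v: "v = dir_deriv M A p (U, \<phi>) w"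
    using assms(1) by (rule tangentE)
  show ?thesis
  proof (cases "smooth_near M A p f")
    case True
    then have h: "smooth_near M A p h" using assms smooth_near_cong by metis
    have "((h \<circ> inv_into U \<phi>) has_derivative (\<lambda>w. dir_deriv M A p (U, \<phi>) w f)) (at (\<phi> p))"
    proof (rule has_derivative_transform_within_open[OF dir_deriv_has_derivative[OF True c]])
      show "open (\<phi> ` (U \<inter> V))" using assms c by (intro open_chart_image)
      show "\<phi> p \<in> \<phi> ` (U \<inter> V)" using assms c by auto
      show "(f \<circ> inv_into U \<phi>) x = (h \<circ> inv_into U \<phi>) x" if "x \<in> \<phi> ` (U \<inter> V)" for x
        using that assms c by auto
    qed
    then show ?thesis unfolding v by (rule dir_deriv_eqI[OF h c, symmetric])
  next
    case False
    then have "\<not> smooth_near M A p h" using assms smooth_near_cong by metis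
    then show ?thesis using False by (simp add: v dir_deriv_def)
  qed
qed

lemma tangent_add:
  assumes "v \<in> tangent_space M A p" "openin M W" "p \<in> W" "smooth_fun A W f" "smooth_fun A W h"
  shows "v (\<lambda>q. f q + h q) = v f + v h"
proof -
  obtain U \<phi> w where c: "(U, \<phi>) \<in> A" "p \<in> U" and v: "v = dir_deriv M A p (U, \<phi>) w"
    using assms(1) by (rule tangentE)
  have s: "smooth_near M A p f" "smooth_near M A p h" "smooth_near M A p (\<lambda>q. f q + h q)"
    using assms by (auto intro: smooth_nearI smooth_fun_add)
  show ?thesis unfolding v
    by (rule dir_deriv_eqI[OF s(3) c])
      (use has_derivative_add[OF dir_deriv_has_derivative[OF s(1) c] dir_deriv_has_derivative[OF s(2) c]]
        in \<open>simp add: comp_def\<close>)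
qed

lemma tangent_const:
  assumes "v \<in> tangent_space M A p" "p \<in> topspace M"
  shows "v (\<lambda>q. k) = 0"
proof -
  obtain U \<phi> w where c: "(U, \<phi>) \<in> A" "p \<in> U" and v: "v = dir_deriv M A p (U, \<phi>) w"
    using assms(1) by (rule tangentE)
  have "smooth_near M A p (\<lambda>q. k)"
    using assms(2) by (intro smooth_nearI[of "topspace M"] smooth_fun_const) auto
  then show ?thesis unfolding v
    by (rule dir_deriv_eqI[OF _ c]) (simp add: comp_def)
qed

lemma dir_deriv_coordinate:
  assumes c: "(U, \<phi>) \<in> A" "p \<in> U"
  shows "dir_deriv M A p (U, \<phi>) w (\<lambda>q. \<phi> q \<bullet> b) = w \<bullet> b"
proof (rule dir_deriv_eqI[OF _ c])
  show "smooth_near M A p (\<lambda>q. \<phi> q \<bullet> b)"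
    using c by (intro smooth_nearI[of U] smooth_fun_coordinate chart_open)
  have "((\<lambda>x. x \<bullet> b) has_derivative (\<lambda>x. x \<bullet> b)) (at (\<phi> p))"
    by (auto intro: derivative_eq_intros)
  then show "((\<lambda>q. \<phi> q \<bullet> b) \<circ> inv_into U \<phi> has_derivative (\<lambda>w. w \<bullet> b)) (at (\<phi> p))"
  proof (rule has_derivative_transform_within_open)
    show "open (\<phi> ` (U \<inter> U))" using c by (intro open_chart_image chart_open)
    show "\<phi> p \<in> \<phi> ` (U \<inter> U)" using c by auto
    show "x \<bullet> b = ((\<lambda>q. \<phi> q \<bullet> b) \<circ> inv_into U \<phi>) x" if "x \<in> \<phi> ` (U \<inter> U)" for x
      using that c by auto
  qed
qed

text \<open>The coordinate functions of the chart recover the components of the direction.\<close>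

lemma inj_dir_deriv:
  assumes "(U, \<phi>) \<in> A" "p \<in> U"
  shows "inj (dir_deriv M A p (U, \<phi>))"
proof (rule injI, rule euclidean_eqI)
  fix x y b assume "dir_deriv M A p (U, \<phi>) x = dir_deriv M A p (U, \<phi>) y"
  then show "x \<bullet> b = y \<bullet> b" using dir_deriv_coordinate[OF assms] by metis
qed

section \<open>Smooth vector fields\<close>

lemma vfield_tangent: "smooth_vfield M A W X \<Longrightarrow> p \<in> W \<Longrightarrow> X p \<in> tangent_space M A p"
  by (simp add: smooth_vfield_def)

lemma vfield_apply_smooth:
  "smooth_vfield M A W X \<Longrightarrow> openin M V \<Longrightarrow> V \<subseteq> W \<Longrightarrow> smooth_fun A V f \<Longrightarrow> smooth_fun A V (\<lambda>p. X p f)"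
  by (simp add: smooth_vfield_def)

lemma vfield_subset: "V \<subseteq> W \<Longrightarrow> smooth_vfield M A W X \<Longrightarrow> smooth_vfield M A V X"
  by (auto simp: smooth_vfield_def)

lemma vfield_cong:
  assumes "smooth_vfield M A W X" "\<And>q. q \<in> W \<Longrightarrow> X q = Y q"
  shows "smooth_vfield M A W Y"
  unfolding smooth_vfield_def
proof (intro conjI ballI allI impI; (elim conjE)?)
  show "Y p \<in> tangent_space M A p" if "p \<in> W" for p
    using assms that vfield_tangent by metis
  fix V f assume V: "openin M V" "V \<subseteq> W" "smooth_fun A V f"
  show "smooth_fun A V (\<lambda>p. Y p f)"
    by (rule smooth_fun_cong[OF V(1) _ vfield_apply_smooth[OF assms(1) V]]) (use V assms in auto)
qed

lemma vfield_add:
  assumes "openin M W" "smooth_vfield M A W X" "smooth_vfield M A W Y"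
  shows "smooth_vfield M A W (X + Y)"
  unfolding smooth_vfield_def
proof (intro conjI ballI allI impI; (elim conjE)?)
  show "(X + Y) p \<in> tangent_space M A p" if "p \<in> W" for p
    using subspace_add[OF subspace_tangent_space vfield_tangent[OF assms(2) that] vfield_tangent[OF assms(3) that]]
      that openin_subset[OF assms(1)] by auto
  fix V f assume V: "openin M V" "V \<subseteq> W" "smooth_fun A V f"
  show "smooth_fun A V (\<lambda>p. (X + Y) p f)"
    using assms V by (simp add: smooth_fun_add vfield_apply_smooth)
qed

lemma vfield_scale:
  assumes "openin M W" "smooth_vfield M A W X" "smooth_fun A W f"
  shows "smooth_vfield M A W (\<lambda>q. f q *\<^sub>R X q)"
  unfolding smooth_vfield_def
proof (intro conjI ballI allI impI; (elim conjE)?)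
  show "f p *\<^sub>R X p \<in> tangent_space M A p" if "p \<in> W" for p
    using assms that openin_subset[OF assms(1)]
    by (intro subspace_scale[OF subspace_tangent_space] vfield_tangent) auto
  fix V h assume V: "openin M V" "V \<subseteq> W" "smooth_fun A V h"
  show "smooth_fun A V (\<lambda>p. (f p *\<^sub>R X p) h)"
    using assms V by (simp add: scaleR_fun_apply smooth_fun_mult vfield_apply_smooth smooth_fun_subset)
qed

lemma vfield_diff:
  assumes "openin M W" "smooth_vfield M A W X" "smooth_vfield M A W Y"
  shows "smooth_vfield M A W (X - Y)"
  by (rule vfield_cong[OF vfield_add[OF assms(1,2) vfield_scale[OF assms(1,3) smooth_fun_const[OF assms(1), of "-1"]]]])
    simp

text \<open>In its own chart the field differentiates in a fixed direction; in another chart the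
  result is precomposed with the transition map, and \<open>Ck_on_compose\<close> applies.\<close>

lemma vfield_coordinate:
  assumes c: "(U, \<phi>) \<in> A"
  shows "smooth_vfield M A U (\<lambda>q. dir_deriv M A q (U, \<phi>) w)"
  unfolding smooth_vfield_def
proof (intro conjI ballI allI impI; (elim conjE)?)
  show "dir_deriv M A p (U, \<phi>) w \<in> tangent_space M A p" if "p \<in> U" for p
    using tangent_space_chart[OF c that] by auto
  fix V f assume V: "openin M V" "V \<subseteq> U" "smooth_fun A V f"
  let ?F = "\<lambda>y. frechet_derivative (f \<circ> inv_into U \<phi>) (at y) w"
  show "smooth_fun A V (\<lambda>p. dir_deriv M A p (U, \<phi>) w f)"
  proof (rule smooth_funI)
    fix U' \<psi> assume c': "(U', \<psi>) \<in> A"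
    have F: "smooth_on (\<phi> ` (U \<inter> V)) ?F"
      by (rule smooth_on_deriv[OF smooth_fun_chart[OF c V(3)]])
    have \<tau>: "smooth_on (\<psi> ` (U' \<inter> V)) (\<phi> \<circ> inv_into U' \<psi>)"
      by (rule smooth_on_subset[OF _ transition_smooth[OF c' c]]) (use V in auto)
    have img: "(\<phi> \<circ> inv_into U' \<psi>) ` (\<psi> ` (U' \<inter> V)) \<subseteq> \<phi> ` (U \<inter> V)" using V c' by auto
    have o: "open (\<psi> ` (U' \<inter> V))" "open (\<phi> ` (U \<inter> V))" using V c c' by (auto intro: open_chart_image)
    have "smooth_on (\<psi> ` (U' \<inter> V)) (\<lambda>x. ?F ((\<phi> \<circ> inv_into U' \<psi>) x))"
      using F \<tau> Ck_on_compose[OF o img] by (auto simp: smooth_on_def)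
    then show "smooth_on (\<psi> ` (U' \<inter> V)) ((\<lambda>p. dir_deriv M A p (U, \<phi>) w f) \<circ> inv_into U' \<psi>)"
    proof (rule smooth_on_cong[OF o(1), rotated])
      fix x assume "x \<in> \<psi> ` (U' \<inter> V)"
      then obtain q where q: "q \<in> U'" "q \<in> V" "x = \<psi> q" by auto
      then have "smooth_near M A q f" using V by (auto intro: smooth_nearI)
      then show "?F ((\<phi> \<circ> inv_into U' \<psi>) x) = ((\<lambda>p. dir_deriv M A p (U, \<phi>) w f) \<circ> inv_into U' \<psi>) x"
        using q c' by (simp add: dir_deriv_def)
    qed
  qed
qed

end

section \<open>Tensoriality and skew symmetries of the curvature\<close>

context manifold
begin

text \<open>Linearity over the smooth functions on every neighbourhood of p; the freedom of
  \<open>W\<close> is what lets its indicator be used as a factor.\<close>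

definition tensorial_at :: "'a \<Rightarrow> ('a vfield \<Rightarrow> 'a tvec) \<Rightarrow> bool" where
  "tensorial_at p T \<longleftrightarrow> (\<forall>W X. openin M W \<and> p \<in> W \<and> smooth_vfield M A W X \<longrightarrow>
     (\<forall>X'. smooth_vfield M A W X' \<longrightarrow> T (X + X') = T X + T X') \<and>
     (\<forall>f. smooth_fun A W f \<longrightarrow> T (\<lambda>q. f q *\<^sub>R X q) = f p *\<^sub>R T X))"

context
  fixes p T assumes T: "tensorial_at p T"
begin

lemma tensorial_add:
  "openin M W \<Longrightarrow> p \<in> W \<Longrightarrow> smooth_vfield M A W X \<Longrightarrow> smooth_vfield M A W X' \<Longrightarrow> T (X + X') = T X + T X'"
  using T by (auto simp: tensorial_at_def)

lemma tensorial_scale: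
  "openin M W \<Longrightarrow> p \<in> W \<Longrightarrow> smooth_vfield M A W X \<Longrightarrow> smooth_fun A W f \<Longrightarrow> T (\<lambda>q. f q *\<^sub>R X q) = f p *\<^sub>R T X"
  using T by (auto simp: tensorial_at_def)

lemma tensorial_local:
  assumes "openin M W" "p \<in> W" "smooth_vfield M A W X" "\<And>q. q \<in> W \<Longrightarrow> X q = X' q"
  shows "T X = T X'"
proof -
  have X': "smooth_vfield M A W X'" using assms(3,4) by (rule vfield_cong)
  \<comment> \<open>The indicator of \<open>W\<close> is smooth on \<open>W\<close>, and multiplying by it makes the two fields equal everywhere.\<close>
  have "(\<lambda>q. indicat_real W q *\<^sub>R X q) = (\<lambda>q. indicat_real W q *\<^sub>R X' q)"
    using assms(4) by (auto simp: indicator_def fun_eq_iff scaleR_fun_apply)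
  then show ?thesis
    using tensorial_scale[OF assms(1,2,3) smooth_fun_indicator[OF assms(1)]]
      tensorial_scale[OF assms(1,2) X' smooth_fun_indicator[OF assms(1)]] assms(2)
    by simp
qed

text \<open>Near p a field is the combination of the coordinate fields with its own values on the
  coordinate functions as coefficients. At p these coefficients involve only \<open>X p\<close>,
  whence \<open>tensorial_value\<close>.\<close>

lemma tensorial_coordinates:
  assumes c: "(U, \<phi>) \<in> A" and p: "p \<in> U" "p \<in> W" and W: "openin M W" "smooth_vfield M A W X"
  shows "T X = (\<Sum>b\<in>Basis. X p (\<lambda>q. \<phi> q \<bullet> b) *\<^sub>R T (\<lambda>q. dir_deriv M A q (U, \<phi>) b))"
proof -
  define V where "V = W \<inter> U"
  have V: "openin M V" "p \<in> V" "V \<subseteq> W" "V \<subseteq> U"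
    using W p chart_open[OF c] by (auto simp: V_def)
  define E where "E = (\<lambda>b q. dir_deriv M A q (U, \<phi>) b)"
  define f where "f = (\<lambda>b q. X q (\<lambda>q. \<phi> q \<bullet> b))"
  have E: "smooth_vfield M A V (E b)" for b
    unfolding E_def by (rule vfield_subset[OF V(4) vfield_coordinate[OF c]])
  have f: "smooth_fun A V (f b)" for b
    unfolding f_def by (rule vfield_apply_smooth[OF W(2) V(1,3) smooth_fun_subset[OF V(4) smooth_fun_coordinate[OF c]]])
  note fE = vfield_scale[OF V(1) E f]
  have sum_T: "smooth_vfield M A V (\<lambda>q. \<Sum>b\<in>B. f b q *\<^sub>R E b q) \<and>
      T (\<lambda>q. \<Sum>b\<in>B. f b q *\<^sub>R E b q) = (\<Sum>b\<in>B. f b p *\<^sub>R T (E b))" if "finite B" for B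
    using that
  proof (induction B)
    case empty
    \<comment> \<open>The zero field is written as a multiple of a coordinate field, because
      tensoriality speaks only of sums and multiples.\<close>
    have "(\<lambda>q. \<Sum>b\<in>{}. f b q *\<^sub>R E b q) = (\<lambda>q. 0 *\<^sub>R E 0 q)" by simp
    then show ?case
      using vfield_scale[OF V(1) E smooth_fun_const[OF V(1), of 0], of 0]
        tensorial_scale[OF V(1,2) E smooth_fun_const[OF V(1), of 0], of 0] by (simp add: func_zero)
  next
    case (insert b B)
    have eq: "(\<lambda>q. \<Sum>b\<in>insert b B. f b q *\<^sub>R E b q) =
        (\<lambda>q. f b q *\<^sub>R E b q) + (\<lambda>q. \<Sum>b\<in>B. f b q *\<^sub>R E b q)"
      using insert.hyps by (simp add: func_plus)
    have "T (\<lambda>q. \<Sum>b\<in>insert b B. f b q *\<^sub>R E b q) =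
        T ((\<lambda>q. f b q *\<^sub>R E b q) + (\<lambda>q. \<Sum>b\<in>B. f b q *\<^sub>R E b q))"
      by (rule arg_cong[OF eq])
    also have "T ((\<lambda>q. f b q *\<^sub>R E b q) + (\<lambda>q. \<Sum>b\<in>B. f b q *\<^sub>R E b q)) =
        f b p *\<^sub>R T (E b) + (\<Sum>b\<in>B. f b p *\<^sub>R T (E b))"
      using tensorial_add[OF V(1,2) fE[of b b]] tensorial_scale[OF V(1,2) E f] insert.IH by simp
    also have "\<dots> = (\<Sum>b\<in>insert b B. f b p *\<^sub>R T (E b))"
      by (rule sum.insert[OF insert.hyps, symmetric])
    finally show ?case
      using vfield_add[OF V(1) fE[of b b] insert.IH[THEN conjunct1]] unfolding eq by simp
  qed
  have "X q = (\<Sum>b\<in>Basis. f b q *\<^sub>R E b q)" if q: "q \<in> V" for q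
  proof -
    have qU: "q \<in> U" using V q by auto
    obtain w where w: "X q = dir_deriv M A q (U, \<phi>) w"
      using vfield_tangent[OF W(2), of q] tangent_space_chart[OF c qU] q V by auto
    have "f b q = w \<bullet> b" for b
      unfolding f_def w by (rule dir_deriv_coordinate[OF c qU])
    then have "(\<Sum>b\<in>Basis. f b q *\<^sub>R E b q) = dir_deriv M A q (U, \<phi>) (\<Sum>b\<in>Basis. (w \<bullet> b) *\<^sub>R b)"
      using linear_dir_deriv[OF c qU] by (simp add: E_def linear_sum linear_scale)
    then show ?thesis by (simp add: w euclidean_representation)
  qed
  then have "T X = T (\<lambda>q. \<Sum>b\<in>Basis. f b q *\<^sub>R E b q)"
    by (intro tensorial_local[OF V(1,2) vfield_subset[OF V(3) W(2)]])
  then show ?thesis using sum_T[OF finite_Basis] by (simp add: f_def E_def)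
qed

lemma tensorial_value:
  assumes "openin M W" "p \<in> W" "smooth_vfield M A W X"
    and "openin M W'" "p \<in> W'" "smooth_vfield M A W' X'" and eq: "X p = X' p"
  shows "T X = T X'"
proof -
  obtain U \<phi> where c: "(U, \<phi>) \<in> A" "p \<in> U"
    using assms openin_subset chart_at by (metis subsetD)
  show ?thesis
    using tensorial_coordinates[OF c assms(2,1,3)] tensorial_coordinates[OF c assms(5,4,6)] eq by simp
qed

end

end

section \<open>Torsion-free connections and tensoriality of their curvature\<close>

locale connection = manifold M A
  for M :: "'a topology" and A :: "('a, 'e::euclidean_space) chart set" +
  fixes D :: "'a vfield \<Rightarrow> 'a vfield \<Rightarrow> 'a vfield"
  assumes affine: "affine_connection M A D"
    and torsion_free: "\<And>W X Y p. openin M W \<Longrightarrow> smooth_vfield M A W X \<Longrightarrow> smooth_vfield M A W Y \<Longrightarrow> p \<in> W \<Longrightarrow>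
      D X Y p - D Y X p = lie_bracket M A X Y p"
begin

context
  fixes W X Y assumes W: "openin M W" and X: "smooth_vfield M A W X" and Y: "smooth_vfield M A W Y"
begin

lemma affine_at:
  "smooth_vfield M A W (D X Y)"
  "\<And>X' p. smooth_vfield M A W X' \<Longrightarrow> p \<in> W \<Longrightarrow> D (X + X') Y p = D X Y p + D X' Y p"
  "\<And>Y' p. smooth_vfield M A W Y' \<Longrightarrow> p \<in> W \<Longrightarrow> D X (Y + Y') p = D X Y p + D X Y' p"
  "\<And>f p. smooth_fun A W f \<Longrightarrow> p \<in> W \<Longrightarrow> D (\<lambda>q. f q *\<^sub>R X q) Y p = f p *\<^sub>R D X Y p"
  "\<And>f p. smooth_fun A W f \<Longrightarrow> p \<in> W \<Longrightarrow> D X (\<lambda>q. f q *\<^sub>R Y q) p = X p f *\<^sub>R Y p + f p *\<^sub>R D X Y p"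
  using affine[unfolded affine_connection_def, rule_format, OF conjI[OF W conjI[OF X Y]]] by blast+

text \<open>Vanishing torsion exhibits the bracket as a difference of smooth fields, which spares a
  computation in coordinates.\<close>

lemma lie_bracket_smooth: "smooth_vfield M A W (lie_bracket M A X Y)"
proof (rule vfield_cong)
  have "smooth_vfield M A W (D Y X)"
    using affine[unfolded affine_connection_def, rule_format, OF conjI[OF W conjI[OF Y X]]] by blast
  then show "smooth_vfield M A W (D X Y - D Y X)" using vfield_diff[OF W affine_at(1)] by blast
  show "(D X Y - D Y X) q = lie_bracket M A X Y q" if "q \<in> W" for q
    using torsion_free[OF W X Y that] by simp
qed

end

lemmas connection_smooth = affine_at(1)
  and connection_add1 = affine_at(2)
  and connection_add2 = affine_at(3)
  and connection_scale1 = affine_at(4)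
  and connection_scale2 = affine_at(5)

text \<open>Multiplication by the indicator of \<open>V\<close> makes fields agreeing on
  \<open>V\<close> equal everywhere, and its value at p is 1.\<close>

lemma connection_local:
  assumes V: "openin M V" "p \<in> V" and X: "smooth_vfield M A V X" and Y: "smooth_vfield M A V Y"
    and "\<And>q. q \<in> V \<Longrightarrow> X q = X' q" "\<And>q. q \<in> V \<Longrightarrow> Y q = Y' q"
  shows "D X Y p = D X' Y' p"
proof -
  define f where "f = (\<lambda>q. indicat_real V q)"
  have f: "smooth_fun A V f" "f p = 1" unfolding f_def using V by (auto intro: smooth_fun_indicator)
  have X': "smooth_vfield M A V X'" and Y': "smooth_vfield M A V Y'"
    using assms by (auto intro: vfield_cong[of _ X] vfield_cong[of _ Y])
  have "(\<lambda>q. f q *\<^sub>R X q) = (\<lambda>q. f q *\<^sub>R X' q)" "(\<lambda>q. f q *\<^sub>R Y q) = (\<lambda>q. f q *\<^sub>R Y' q)"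
    using assms(5,6) by (auto simp: f_def indicator_def fun_eq_iff scaleR_fun_apply)
  note eq = this
  have "D X Y p = D X' Y p"
    using connection_scale1[OF V(1) X Y f(1) V(2)] connection_scale1[OF V(1) X' Y f(1) V(2)] eq f by simp
  also have "\<dots> = D X' Y' p"
  proof -
    \<comment> \<open>The extra Leibniz term vanishes, as the indicator is constant near p.\<close>
    have "X' p f = X' p (\<lambda>q. 1)"
      by (rule tangent_cong[OF vfield_tangent[OF X' V(2)] V]) (simp add: f_def)
    then have "X' p f = 0"
      using tangent_const[OF vfield_tangent[OF X' V(2)]] V openin_subset by fastforce
    then show ?thesis
      using connection_scale2[OF V(1) X' Y f(1) V(2)] connection_scale2[OF V(1) X' Y' f(1) V(2)] eq f by simp
  qed
  finally show ?thesis .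
qed

lemma connection_diff1:
  assumes "openin M W" "smooth_vfield M A W X" "smooth_vfield M A W X'" "smooth_vfield M A W Y" "p \<in> W"
  shows "D (X - X') Y p = D X Y p - D X' Y p"
proof -
  have "D ((X - X') + X') Y p = D (X - X') Y p + D X' Y p"
    using assms by (intro connection_add1 vfield_diff)
  then show ?thesis by simp
qed

abbreviation "curv \<equiv> curvature_operator M A D"

lemma curv_apply:
  "curv X Y Z p = D X (D Y Z) p - D Y (D X Z) p - D (lie_bracket M A X Y) Z p"
  unfolding curvature_operator_def by (simp only: minus_apply[of "D X (D Y Z) - D Y (D X Z)"] minus_apply[of "D X (D Y Z)"])

context
  fixes W p assumes W: "openin M W" "p \<in> W"
begin

private lemmas nabla = connection_smooth[OF W(1)]

lemma curv_smooth:
  assumes X: "smooth_vfield M A W X" and Y: "smooth_vfield M A W Y" and Z: "smooth_vfield M A W Z"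
  shows "smooth_vfield M A W (curv X Y Z)"
  unfolding curvature_operator_def
  by (intro vfield_diff W nabla X Y Z lie_bracket_smooth)

text \<open>Eliminating the bracket by vanishing torsion expresses the curvature through
  \<open>D\<close> alone; skewness and linearity in the first argument then follow from the
  connection axioms.\<close>

lemma curv_eq:
  assumes X: "smooth_vfield M A W X" and Y: "smooth_vfield M A W Y" and Z: "smooth_vfield M A W Z"
  shows "curv X Y Z p = D X (D Y Z) p - D Y (D X Z) p - (D (D X Y) Z p - D (D Y X) Z p)"
proof -
  have "D (lie_bracket M A X Y) Z p = D (D X Y - D Y X) Z p"
    by (rule connection_local[OF W lie_bracket_smooth[OF W(1) X Y] Z])
      (use torsion_free[OF W(1) X Y] in auto)
  also have "\<dots> = D (D X Y) Z p - D (D Y X) Z p"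
    by (rule connection_diff1[OF W(1) nabla[OF X Y] nabla[OF Y X] Z W(2)])
  finally show ?thesis by (simp add: curvature_operator_def)
qed

lemma curv_skew:
  assumes X: "smooth_vfield M A W X" and Y: "smooth_vfield M A W Y" and Z: "smooth_vfield M A W Z"
  shows "curv X Y Z p = - curv Y X Z p"
  unfolding curv_eq[OF X Y Z] curv_eq[OF Y X Z] by simp

lemma curv_add1:
  assumes X: "smooth_vfield M A W X" and X': "smooth_vfield M A W X'"
    and Y: "smooth_vfield M A W Y" and Z: "smooth_vfield M A W Z"
  shows "curv (X + X') Y Z p = curv X Y Z p + curv X' Y Z p"
proof -
  note add = vfield_add[OF W(1) X X']
  note a1 = connection_add1[OF W(1)]
  note a2 = connection_add2[OF W(1)]
  have "D Y (D (X + X') Z) p = D Y (D X Z + D X' Z) p"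
    by (rule connection_local[OF W Y nabla[OF add Z]]) (simp_all add: a1[OF X Z X'])
  also have "\<dots> = D Y (D X Z) p + D Y (D X' Z) p"
    by (rule a2[OF Y nabla[OF X Z] nabla[OF X' Z] W(2)])
  finally have 1: "D Y (D (X + X') Z) p = D Y (D X Z) p + D Y (D X' Z) p" .
  have "D (D (X + X') Y) Z p = D (D X Y + D X' Y) Z p"
    by (rule connection_local[OF W nabla[OF add Y] Z]) (simp_all add: a1[OF X Y X'])
  also have "\<dots> = D (D X Y) Z p + D (D X' Y) Z p"
    by (rule a1[OF nabla[OF X Y] Z nabla[OF X' Y] W(2)])
  finally have 2: "D (D (X + X') Y) Z p = D (D X Y) Z p + D (D X' Y) Z p" .
  have "D (D Y (X + X')) Z p = D (D Y X + D Y X') Z p"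
    by (rule connection_local[OF W nabla[OF Y add] Z]) (simp_all add: a2[OF Y X X'])
  also have "\<dots> = D (D Y X) Z p + D (D Y X') Z p"
    by (rule a1[OF nabla[OF Y X] Z nabla[OF Y X'] W(2)])
  finally have 3: "D (D Y (X + X')) Z p = D (D Y X) Z p + D (D Y X') Z p" .
  have 4: "D (X + X') (D Y Z) p = D X (D Y Z) p + D X' (D Y Z) p"
    by (rule a1[OF X nabla[OF Y Z] X' W(2)])
  show ?thesis unfolding curv_eq[OF add Y Z] curv_eq[OF X Y Z] curv_eq[OF X' Y Z] 1 2 3 4
    by (simp only: algebra_simps)
qed

text \<open>The derivative of f enters twice, through D Y (f D X Z) and through D (D Y (f X)) Z, and
  the two terms \<open>Y p f *\<^sub>R D X Z p\<close> cancel.\<close>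

lemma curv_scale1:
  assumes X: "smooth_vfield M A W X" and f: "smooth_fun A W f"
    and Y: "smooth_vfield M A W Y" and Z: "smooth_vfield M A W Z"
  shows "curv (\<lambda>q. f q *\<^sub>R X q) Y Z p = f p *\<^sub>R curv X Y Z p"
proof -
  note fX = vfield_scale[OF W(1) X f]
  note s1 = connection_scale1[OF W(1)]
  note s2 = connection_scale2[OF W(1)]
  note Yf = vfield_apply_smooth[OF Y W(1) subset_refl f]
  have "D Y (D (\<lambda>q. f q *\<^sub>R X q) Z) p = D Y (\<lambda>q. f q *\<^sub>R D X Z q) p"
    by (rule connection_local[OF W Y nabla[OF fX Z]]) (simp_all add: s1[OF X Z f])
  also have "\<dots> = Y p f *\<^sub>R D X Z p + f p *\<^sub>R D Y (D X Z) p"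
    by (rule s2[OF Y nabla[OF X Z] f W(2)])
  finally have 1: "D Y (D (\<lambda>q. f q *\<^sub>R X q) Z) p = Y p f *\<^sub>R D X Z p + f p *\<^sub>R D Y (D X Z) p" .
  have "D (D (\<lambda>q. f q *\<^sub>R X q) Y) Z p = D (\<lambda>q. f q *\<^sub>R D X Y q) Z p"
    by (rule connection_local[OF W nabla[OF fX Y] Z]) (simp_all add: s1[OF X Y f])
  also have "\<dots> = f p *\<^sub>R D (D X Y) Z p"
    by (rule s1[OF nabla[OF X Y] Z f W(2)])
  finally have 2: "D (D (\<lambda>q. f q *\<^sub>R X q) Y) Z p = f p *\<^sub>R D (D X Y) Z p" .
  have "D (D Y (\<lambda>q. f q *\<^sub>R X q)) Z p = D ((\<lambda>q. Y q f *\<^sub>R X q) + (\<lambda>q. f q *\<^sub>R D Y X q)) Z p"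
    by (rule connection_local[OF W nabla[OF Y fX] Z]) (simp_all add: s2[OF Y X f])
  also have "\<dots> = D (\<lambda>q. Y q f *\<^sub>R X q) Z p + D (\<lambda>q. f q *\<^sub>R D Y X q) Z p"
    by (rule connection_add1[OF W(1) vfield_scale[OF W(1) X Yf] Z vfield_scale[OF W(1) nabla[OF Y X] f] W(2)])
  also have "\<dots> = Y p f *\<^sub>R D X Z p + f p *\<^sub>R D (D Y X) Z p"
    by (simp only: s1[OF X Z Yf W(2)] s1[OF nabla[OF Y X] Z f W(2)])
  finally have 3: "D (D Y (\<lambda>q. f q *\<^sub>R X q)) Z p = Y p f *\<^sub>R D X Z p + f p *\<^sub>R D (D Y X) Z p" .
  have 4: "D (\<lambda>q. f q *\<^sub>R X q) (D Y Z) p = f p *\<^sub>R D X (D Y Z) p"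
    by (rule s1[OF X nabla[OF Y Z] f W(2)])
  show ?thesis unfolding curv_eq[OF fX Y Z] curv_eq[OF X Y Z] 1 2 3 4
    by (simp only: algebra_simps)
qed

lemma curv_add3:
  assumes X: "smooth_vfield M A W X" and Y: "smooth_vfield M A W Y"
    and Z: "smooth_vfield M A W Z" and Z': "smooth_vfield M A W Z'"
  shows "curv X Y (Z + Z') p = curv X Y Z p + curv X Y Z' p"
proof -
  note add = vfield_add[OF W(1) Z Z']
  note a2 = connection_add2[OF W(1)]
  have DD: "D X (D Y (Z + Z')) p = D X (D Y Z) p + D X (D Y Z') p"
    if X: "smooth_vfield M A W X" and Y: "smooth_vfield M A W Y" for X Y
  proof -
    have "D X (D Y (Z + Z')) p = D X (D Y Z + D Y Z') p"
      by (rule connection_local[OF W X nabla[OF Y add]]) (simp_all add: a2[OF Y Z Z'])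
    also have "\<dots> = D X (D Y Z) p + D X (D Y Z') p"
      by (rule a2[OF X nabla[OF Y Z] nabla[OF Y Z'] W(2)])
    finally show ?thesis .
  qed
  show ?thesis
    unfolding curv_apply DD[OF X Y] DD[OF Y X]
      a2[OF lie_bracket_smooth[OF W(1) X Y] Z Z' W(2)]
    by (simp only: algebra_simps)
qed

text \<open>First derivatives of f occur symmetrically in X and Y, and the second derivatives form
  the bracket applied to f, which the last term of the curvature removes.\<close>

lemma curv_scale3:
  assumes X: "smooth_vfield M A W X" and Y: "smooth_vfield M A W Y"
    and Z: "smooth_vfield M A W Z" and f: "smooth_fun A W f"
  shows "curv X Y (\<lambda>q. f q *\<^sub>R Z q) p = f p *\<^sub>R curv X Y Z p"
proof -
  note fZ = vfield_scale[OF W(1) Z f]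
  note s2 = connection_scale2[OF W(1)]
  have DD: "D X (D Y (\<lambda>q. f q *\<^sub>R Z q)) p =
      X p (\<lambda>q. Y q f) *\<^sub>R Z p + Y p f *\<^sub>R D X Z p + (X p f *\<^sub>R D Y Z p + f p *\<^sub>R D X (D Y Z) p)"
    if X: "smooth_vfield M A W X" and Y: "smooth_vfield M A W Y" for X Y
  proof -
    note Yf = vfield_apply_smooth[OF Y W(1) subset_refl f]
    have "D X (D Y (\<lambda>q. f q *\<^sub>R Z q)) p = D X ((\<lambda>q. Y q f *\<^sub>R Z q) + (\<lambda>q. f q *\<^sub>R D Y Z q)) p"
      by (rule connection_local[OF W X nabla[OF Y fZ]]) (simp_all add: s2[OF Y Z f])
    also have "\<dots> = D X (\<lambda>q. Y q f *\<^sub>R Z q) p + D X (\<lambda>q. f q *\<^sub>R D Y Z q) p"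
      by (rule connection_add2[OF W(1) X vfield_scale[OF W(1) Z Yf] vfield_scale[OF W(1) nabla[OF Y Z] f] W(2)])
    finally show ?thesis by (simp only: s2[OF X Z Yf W(2)] s2[OF X nabla[OF Y Z] f W(2)])
  qed
  have "lie_bracket M A X Y p f = X p (\<lambda>q. Y q f) - Y p (\<lambda>q. X q f)"
    using smooth_nearI[OF W f] by (simp add: lie_bracket_def)
  then have L: "D (lie_bracket M A X Y) (\<lambda>q. f q *\<^sub>R Z q) p =
      (X p (\<lambda>q. Y q f) - Y p (\<lambda>q. X q f)) *\<^sub>R Z p + f p *\<^sub>R D (lie_bracket M A X Y) Z p"
    using s2[OF lie_bracket_smooth[OF W(1) X Y] Z f W(2)] by simp
  show ?thesis
    unfolding curv_apply DD[OF X Y] DD[OF Y X] L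
    by (simp only: algebra_simps)
qed

end

lemma tensorial_curv1:
  assumes W: "openin M W" "p \<in> W" and Y: "smooth_vfield M A W Y" and Z: "smooth_vfield M A W Z"
  shows "tensorial_at p (\<lambda>X. curv X Y Z p)"
  unfolding tensorial_at_def
proof (intro allI impI conjI; elim conjE)
  fix V X assume V: "openin M V" "p \<in> V" "smooth_vfield M A V X"
  have N: "openin M (V \<inter> W)" "p \<in> V \<inter> W" using V W by auto
  note sub = vfield_subset[of "V \<inter> W" V, OF Int_lower1] vfield_subset[of "V \<inter> W" W, OF Int_lower2]
  show "curv (X + X') Y Z p = curv X Y Z p + curv X' Y Z p" if "smooth_vfield M A V X'" for X'
    using that V Y Z by (intro curv_add1[OF N] sub)
  show "curv (\<lambda>q. f q *\<^sub>R X q) Y Z p = f p *\<^sub>R curv X Y Z p" if "smooth_fun A V f" for f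
    using that V Y Z by (intro curv_scale1[OF N] sub smooth_fun_subset[of "V \<inter> W" V, OF Int_lower1])
qed

lemma tensorial_curv3:
  assumes W: "openin M W" "p \<in> W" and X: "smooth_vfield M A W X" and Y: "smooth_vfield M A W Y"
  shows "tensorial_at p (\<lambda>Z. curv X Y Z p)"
  unfolding tensorial_at_def
proof (intro allI impI conjI; elim conjE)
  fix V Z assume V: "openin M V" "p \<in> V" "smooth_vfield M A V Z"
  have N: "openin M (V \<inter> W)" "p \<in> V \<inter> W" using V W by auto
  note sub = vfield_subset[of "V \<inter> W" V, OF Int_lower1] vfield_subset[of "V \<inter> W" W, OF Int_lower2]
  show "curv X Y (Z + Z') p = curv X Y Z p + curv X Y Z' p" if "smooth_vfield M A V Z'" for Z'
    using that V X Y by (intro curv_add3[OF N] sub)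
  show "curv X Y (\<lambda>q. f q *\<^sub>R Z q) p = f p *\<^sub>R curv X Y Z p" if "smooth_fun A V f" for f
    using that V X Y by (intro curv_scale3[OF N] sub smooth_fun_subset[of "V \<inter> W" V, OF Int_lower1])
qed

text \<open>One argument is replaced at a time; skewness brings the second into first place.\<close>

lemma curv_cong_value:
  assumes W: "openin M W" "p \<in> W"
    and X: "smooth_vfield M A W X" and Y: "smooth_vfield M A W Y" and Z: "smooth_vfield M A W Z"
    and X': "smooth_vfield M A W X'" and Y': "smooth_vfield M A W Y'" and Z': "smooth_vfield M A W Z'"
    and eq: "X p = X' p" "Y p = Y' p" "Z p = Z' p"
  shows "curv X Y Z p = curv X' Y' Z' p"
proof -
  have "curv X Y Z p = curv X' Y Z p"
    by (rule tensorial_value[OF tensorial_curv1[OF W Y Z] W X W X' eq(1)])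
  also have "\<dots> = - curv Y X' Z p" by (rule curv_skew[OF W X' Y Z])
  also have "curv Y X' Z p = curv Y' X' Z p"
    by (rule tensorial_value[OF tensorial_curv1[OF W X' Z] W Y W Y' eq(2)])
  also have "- \<dots> = curv X' Y' Z p" by (rule curv_skew[OF W X' Y' Z, symmetric])
  also have "\<dots> = curv X' Y' Z' p"
    by (rule tensorial_value[OF tensorial_curv3[OF W X' Y'] W Z W Z' eq(3)])
  finally show ?thesis .
qed

text \<open>Fields over another neighbourhood are compared on the intersection; uniqueness of the
  described value holds because the given fields themselves are admissible.\<close>

lemma curvature_at_eq:
  assumes W: "openin M W" "p \<in> W"
    and X: "smooth_vfield M A W X" and Y: "smooth_vfield M A W Y" and Z: "smooth_vfield M A W Z"
  shows "curvature_at M A D p (X p) (Y p) (Z p) = curv X Y Z p"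
  unfolding curvature_at_def
proof (rule the_equality)
  show "\<forall>V X' Y' Z'. openin M V \<and> p \<in> V \<and> smooth_vfield M A V X' \<and> smooth_vfield M A V Y' \<and>
      smooth_vfield M A V Z' \<and> X' p = X p \<and> Y' p = Y p \<and> Z' p = Z p \<longrightarrow> curv X' Y' Z' p = curv X Y Z p"
  proof (intro allI impI; elim conjE)
    fix V X' Y' Z'
    assume V: "openin M V" "p \<in> V" "smooth_vfield M A V X'" "smooth_vfield M A V Y'" "smooth_vfield M A V Z'"
      and eq: "X' p = X p" "Y' p = Y p" "Z' p = Z p"
    have N: "openin M (V \<inter> W)" "p \<in> V \<inter> W" using V W by auto
    note sub = vfield_subset[of "V \<inter> W" V, OF Int_lower1] vfield_subset[of "V \<inter> W" W, OF Int_lower2]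
    show "curv X' Y' Z' p = curv X Y Z p"
      by (rule curv_cong_value[OF N sub(1)[OF V(3)] sub(1)[OF V(4)] sub(1)[OF V(5)]
            sub(2)[OF X] sub(2)[OF Y] sub(2)[OF Z] eq])
  qed
qed (use W X Y Z in blast)

end

section \<open>Metric connections\<close>

locale metric_connection = connection M A D
  for M :: "'a topology" and A :: "('a, 'e::euclidean_space) chart set" and D +
  fixes g :: "'a \<Rightarrow> 'a tvec \<Rightarrow> 'a tvec \<Rightarrow> real"
  assumes metric: "pseudo_riemannian_metric M A g"
    and compatible: "\<And>W X Y Z p. openin M W \<Longrightarrow> smooth_vfield M A W X \<Longrightarrow> smooth_vfield M A W Y \<Longrightarrow>
      smooth_vfield M A W Z \<Longrightarrow> p \<in> W \<Longrightarrow>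
      X p (\<lambda>q. g q (Y q) (Z q)) = g p (D X Y p) (Z p) + g p (Y p) (D X Z p)"
begin

lemma g_smooth:
  "openin M W \<Longrightarrow> smooth_vfield M A W X \<Longrightarrow> smooth_vfield M A W Y \<Longrightarrow> smooth_fun A W (\<lambda>p. g p (X p) (Y p))"
  using metric by (simp add: pseudo_riemannian_metric_def)

context
  fixes p assumes p: "p \<in> topspace M"
begin

lemma g_sym: "u \<in> tangent_space M A p \<Longrightarrow> v \<in> tangent_space M A p \<Longrightarrow> g p u v = g p v u"
  using metric p by (simp add: pseudo_riemannian_metric_def)

lemma g_nondegenerate:
  "u \<in> tangent_space M A p \<Longrightarrow> (\<And>v. v \<in> tangent_space M A p \<Longrightarrow> g p u v = 0) \<Longrightarrow> u = 0"
  using metric p by (simp add: pseudo_riemannian_metric_def)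

lemma g_comb:
  "u \<in> tangent_space M A p \<Longrightarrow> v \<in> tangent_space M A p \<Longrightarrow> w \<in> tangent_space M A p \<Longrightarrow>
    g p (a *\<^sub>R u + b *\<^sub>R v) w = a * g p u w + b * g p v w"
  using metric p by (simp add: pseudo_riemannian_metric_def)

lemma g_add: "u \<in> tangent_space M A p \<Longrightarrow> v \<in> tangent_space M A p \<Longrightarrow> w \<in> tangent_space M A p \<Longrightarrow>
    g p (u + v) w = g p u w + g p v w"
  using g_comb[of u v w 1 1] by simp

lemma g_scale: "u \<in> tangent_space M A p \<Longrightarrow> w \<in> tangent_space M A p \<Longrightarrow> g p (a *\<^sub>R u) w = a * g p u w"
  using g_comb[of u u w a 0] by simp

lemma g_diff: "u \<in> tangent_space M A p \<Longrightarrow> v \<in> tangent_space M A p \<Longrightarrow> w \<in> tangent_space M A p \<Longrightarrow>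
    g p (u - v) w = g p u w - g p v w"
  using g_comb[of u v w 1 "-1"] by simp

end

lemma curv_metric_skew:
  assumes W: "openin M W" "p \<in> W"
    and X: "smooth_vfield M A W X" and Y: "smooth_vfield M A W Y" and Z: "smooth_vfield M A W Z"
  shows "g p (curv X Y Z p) (Z p) = 0"
proof -
  have p: "p \<in> topspace M" using W openin_subset by blast
  note nabla = connection_smooth[OF W(1)]
  note tan = vfield_tangent[OF _ W(2)]
  \<comment> \<open>Compare \<open>[X,Y]\<close> and \<open>XY - YX\<close> on the function \<open>g(Z,Z)\<close>.\<close>
  define h where "h = (\<lambda>q. g q (Z q) (Z q))"
  have h: "smooth_fun A W h" unfolding h_def by (rule g_smooth[OF W(1) Z Z])
  have first: "Y q h = g q (D Y Z q) (Z q) + g q (D Y Z q) (Z q)"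
    if Y: "smooth_vfield M A W Y" and q: "q \<in> W" for Y q
    using compatible[OF W(1) Y Z Z q] g_sym[OF _ vfield_tangent[OF Z q] vfield_tangent[OF nabla[OF Y Z] q]]
      q openin_subset[OF W(1)] by (auto simp: h_def)
  have second: "X p (\<lambda>q. Y q h) = 2 * (g p (D X (D Y Z) p) (Z p) + g p (D Y Z p) (D X Z p))"
    if X: "smooth_vfield M A W X" and Y: "smooth_vfield M A W Y" for X Y
  proof -
    note k = g_smooth[OF W(1) nabla[OF Y Z] Z]
    have "X p (\<lambda>q. Y q h) = X p (\<lambda>q. g q (D Y Z q) (Z q) + g q (D Y Z q) (Z q))"
      by (rule tangent_cong[OF tan[OF X] W]) (rule first[OF Y])
    also have "\<dots> = X p (\<lambda>q. g q (D Y Z q) (Z q)) + X p (\<lambda>q. g q (D Y Z q) (Z q))"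
      by (rule tangent_add[OF tan[OF X] W k k])
    finally show ?thesis using compatible[OF W(1) X nabla[OF Y Z] Z W(2)] by simp
  qed
  note L = lie_bracket_smooth[OF W(1) X Y]
  have "lie_bracket M A X Y p h = X p (\<lambda>q. Y q h) - Y p (\<lambda>q. X q h)"
    using smooth_nearI[OF W h] by (simp add: lie_bracket_def)
  \<comment> \<open>The products of D X Z with D Y Z are symmetric in X and Y and drop out of the
    difference.\<close>
  then have "g p (D (lie_bracket M A X Y) Z p) (Z p) =
      g p (D X (D Y Z) p) (Z p) - g p (D Y (D X Z) p) (Z p)"
    using first[OF L W(2)] second[OF X Y] second[OF Y X]
      g_sym[OF p tan[OF nabla[OF X Z]] tan[OF nabla[OF Y Z]]] by simp
  moreover have "g p (curv X Y Z p) (Z p) =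
      g p (D X (D Y Z) p) (Z p) - g p (D Y (D X Z) p) (Z p) - g p (D (lie_bracket M A X Y) Z p) (Z p)"
  proof -
    note t = tan[OF nabla[OF X nabla[OF Y Z]]] tan[OF nabla[OF Y nabla[OF X Z]]]
      tan[OF nabla[OF L Z]] tan[OF Z]
    have "D X (D Y Z) p - D Y (D X Z) p \<in> tangent_space M A p"
      by (rule subspace_diff[OF subspace_tangent_space[OF p] t(1,2)])
    then show ?thesis
      unfolding curv_apply by (simp only: g_diff[OF p] t)
  qed
  ultimately show ?thesis by simp
qed

end

section \<open>Almost Hermitian manifolds\<close>

lemma span_pair: "span {x, y} = {a *\<^sub>R x + b *\<^sub>R y | a b. True}"
proof (intro subset_antisym subsetI)
  fix v assume "v \<in> span {x, y}"
  then show "v \<in> {a *\<^sub>R x + b *\<^sub>R y | a b. True}"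
    by (auto simp: span_insert span_singleton) (metis diff_add_cancel add.commute)
qed (auto intro!: span_add span_scale intro: span_base)

section \<open>One tangent space carried over to the model space of a chart\<close>

locale almost_hermitian_point = metric_connection M A D g
  for M :: "'a topology" and A :: "('a, 'e::euclidean_space) chart set" and D g +
  fixes J :: "'a \<Rightarrow> 'a tvec \<Rightarrow> 'a tvec" and p and U and \<phi>
  assumes hermitian: "almost_hermitian_manifold M A g J"
    and chart: "(U, \<phi>) \<in> A" "p \<in> U"
begin

abbreviation "TM \<equiv> tangent_space M A p"
abbreviation "tang \<equiv> dir_deriv M A p (U, \<phi>)"

text \<open>Constant components in the chart give each tangent vector at p a smooth extension over
  \<open>U\<close>.\<close>

definition field :: "'e \<Rightarrow> 'a vfield" where "field w = (\<lambda>q. dir_deriv M A q (U, \<phi>) w)"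
definition G :: "'e \<Rightarrow> 'e \<Rightarrow> real" where "G x y = g p (tang x) (tang y)"
definition jj :: "'e \<Rightarrow> 'e" where "jj x = inv tang (J p (tang x))"
text \<open>Stated with fields instead of \<open>curvature_at\<close>, so that tensoriality applies
  directly; \<open>curvature_tensor_tang\<close> identifies the two.\<close>

definition R :: "'e \<Rightarrow> 'e \<Rightarrow> 'e \<Rightarrow> 'e \<Rightarrow> real" where
  "R x y z u = g p (curv (field x) (field y) (field z) p) (tang u)"

lemma p_in: "p \<in> topspace M"
  using chart chart_subset by blast

lemmas U_open = chart_open[OF chart(1)] chart(2)
lemmas lin = linear_dir_deriv[OF chart]
lemmas field_smooth = vfield_coordinate[OF chart(1), folded field_def]
lemmas subspace_TM = subspace_tangent_space[OF p_in]

lemma TM_eq: "TM = range tang"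
  by (rule tangent_space_chart[OF chart])

lemma tang_TM [simp]: "tang x \<in> TM"
  by (simp add: TM_eq)

lemma inj_tang: "inj tang"
  by (rule inj_dir_deriv[OF chart])

lemma tang_simps: "tang (x + y) = tang x + tang y" "tang (r *\<^sub>R x) = r *\<^sub>R tang x" "tang 0 = 0"
  using lin by (auto simp: linear_add linear_scale linear_0)

lemma tang_eq_0 [simp]: "tang x = 0 \<longleftrightarrow> x = 0"
  using inj_tang tang_simps(3) by (metis injD)

lemma field_p: "field x p = tang x"
  by (simp add: field_def)

lemma J_TM: "u \<in> TM \<Longrightarrow> J p u \<in> TM" and J_J: "u \<in> TM \<Longrightarrow> J p (J p u) = - u"
  and J_comb: "u \<in> TM \<Longrightarrow> v \<in> TM \<Longrightarrow> J p (a *\<^sub>R u + b *\<^sub>R v) = a *\<^sub>R J p u + b *\<^sub>R J p v"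
  and g_J: "u \<in> TM \<Longrightarrow> v \<in> TM \<Longrightarrow> g p (J p u) (J p v) = g p u v"
  using hermitian p_in by (simp_all add: almost_hermitian_manifold_def almost_complex_structure_def)

lemma tang_jj: "tang (jj x) = J p (tang x)"
  unfolding jj_def using J_TM[OF tang_TM] TM_eq f_inv_into_f[of "J p (tang x)" tang UNIV] by simp

lemma curv_TM: "curv (field x) (field y) (field z) p \<in> TM"
  by (rule vfield_tangent[OF curv_smooth[OF U_open field_smooth field_smooth field_smooth] chart(2)])

text \<open>Linearity of \<open>field w\<close> in w is available only on \<open>U\<close>;
  tensoriality reduces the claim to the values at p.\<close>

lemma tensorial_field_linear:
  assumes T: "tensorial_at p T"
  shows "T (field (x + y)) = T (field x) + T (field y)" "T (field (r *\<^sub>R x)) = r *\<^sub>R T (field x)"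
proof -
  have "T (field (x + y)) = T (field x + field y)"
    by (rule tensorial_value[OF T U_open field_smooth U_open vfield_add[OF U_open(1) field_smooth field_smooth]])
      (simp add: field_p tang_simps)
  then show "T (field (x + y)) = T (field x) + T (field y)"
    using tensorial_add[OF T U_open field_smooth field_smooth] by simp
  note c = smooth_fun_const[OF U_open(1), of r]
  have "T (field (r *\<^sub>R x)) = T (\<lambda>q. r *\<^sub>R field x q)"
    by (rule tensorial_value[OF T U_open field_smooth U_open vfield_scale[OF U_open(1) field_smooth c]])
      (simp add: field_p tang_simps)
  then show "T (field (r *\<^sub>R x)) = r *\<^sub>R T (field x)"
    using tensorial_scale[OF T U_open field_smooth c] by simp
qed

lemma g_tang_add: "u \<in> TM \<Longrightarrow> v \<in> TM \<Longrightarrow> g p (u + v) (tang w) = g p u (tang w) + g p v (tang w)"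
  and g_tang_scale: "u \<in> TM \<Longrightarrow> g p (r *\<^sub>R u) (tang w) = r * g p u (tang w)"
  using g_add[OF p_in] g_scale[OF p_in] by auto

sublocale hermitian_curvature G jj R
proof (rule hermitian_curvature.intro)
  note T1 = tensorial_field_linear[OF tensorial_curv1[OF U_open field_smooth field_smooth]]
  note T3 = tensorial_field_linear[OF tensorial_curv3[OF U_open field_smooth field_smooth]]
  fix x y z u :: 'e
  show "linear (\<lambda>x. G x y)"
    by (rule linearI) (simp_all add: G_def tang_simps g_tang_add g_tang_scale)
  show "G x y = G y x" by (simp add: G_def g_sym[OF p_in])
  show "x = 0" if "\<And>y. G x y = 0"
    using g_nondegenerate[OF p_in tang_TM, of x] that by (auto simp: G_def TM_eq)
  show "linear jj"
  proof (rule linearI; rule injD[OF inj_tang])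
    show "tang (jj (a + b)) = tang (jj a + jj b)" for a b
      using J_comb[of "tang a" "tang b" 1 1] by (simp add: tang_jj tang_simps)
    show "tang (jj (r *\<^sub>R a)) = tang (r *\<^sub>R jj a)" for a r
      using J_comb[of "tang a" "tang a" r 0] by (simp add: tang_jj tang_simps)
  qed
  show "jj (jj x) = - x"
    by (rule injD[OF inj_tang]) (simp add: tang_jj J_J linear_neg[OF lin])
  show "G (jj x) (jj y) = G x y" by (simp add: G_def tang_jj g_J)
  show "linear (\<lambda>x. R x y z u)"
    by (rule linearI) (simp_all add: R_def T1 curv_TM g_tang_add g_tang_scale)
  have lin3: "linear (\<lambda>z. R x y z u)" for x y u
    by (rule linearI) (simp_all add: R_def T3 curv_TM g_tang_add g_tang_scale)
  then show "linear (\<lambda>z. R x y z u)" .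
  show "R x y z u = - R y x z u"
    unfolding R_def curv_skew[OF U_open field_smooth field_smooth field_smooth, of x y z]
    using g_tang_scale[OF curv_TM, of "-1" y x z u] by simp
  \<comment> \<open>Skewness in the last two arguments is the polarisation of this identity, applied
    below to w = z + u.\<close>
  have 0: "R x y w w = 0" for w
    using curv_metric_skew[OF U_open field_smooth field_smooth field_smooth] by (simp add: R_def field_p)
  have lin4: "R x y z (u + v) = R x y z u + R x y z v" for z u v
    unfolding R_def tang_simps
    using g_add[OF p_in tang_TM tang_TM curv_TM] by (simp add: g_sym[OF p_in curv_TM] tang_simps subspace_add[OF subspace_TM])
  have "R x y (z + u) (z + u) = R x y z u + R x y u z"
    by (simp add: lin4 linear_add[OF lin3] 0)
  then show "R x y z u = - R x y u z" using 0 by simp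
qed

section \<open>Antiholomorphic planes and their sectional curvature\<close>

lemma curvature_tensor_tang: "curvature_tensor M A g D p (tang x) (tang y) (tang z) (tang u) = R x y z u"
  unfolding curvature_tensor_def R_def
  using curvature_at_eq[OF U_open field_smooth field_smooth field_smooth, of x y z] by (simp add: field_p)

lemma span_tang_image: "span (tang ` S) = tang ` span S"
  by (rule linear_span_image[OF lin])

lemma span_tang: "span {tang x, tang y} = tang ` span {x, y}"
  using span_tang_image[of "{x, y}"] by simp

text \<open>Numerator and denominator change by the same squared determinant, so every spanning pair
  gives the quotient of this one and the description is determined.\<close>

lemma sectional_curvature_span:
  assumes "gram x y \<noteq> 0"
  shows "sectional_curvature M A g D p (span {tang x, tang y}) = R x y y x / gram x y"
  unfolding sectional_curvature_def
proof (rule the_equality)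
  have gram_g: "g p (tang x) (tang x) * g p (tang y) (tang y) - (g p (tang x) (tang y))\<^sup>2 = gram x y" for x y
    by (simp add: gram_def G_def)
  show "\<forall>u v. span {u, v} = span {tang x, tang y} \<longrightarrow> R x y y x / gram x y =
      curvature_tensor M A g D p u v v u / (g p u u * g p v v - (g p u v)\<^sup>2)"
  proof (intro allI impI)
    fix u v assume eq: "span {u, v} = span {tang x, tang y}"
    have "u \<in> tang ` span {x, y}" "v \<in> tang ` span {x, y}"
      using span_base[of u "{u, v}"] span_base[of v "{u, v}"] unfolding eq span_tang by auto
    then obtain a b c d where u: "u = tang (a *\<^sub>R x + b *\<^sub>R y)" and v: "v = tang (c *\<^sub>R x + d *\<^sub>R y)"
      unfolding span_pair by blast
    let ?u = "a *\<^sub>R x + b *\<^sub>R y" and ?v = "c *\<^sub>R x + d *\<^sub>R y"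
    have sp: "span {tang x, tang y} = tang ` span {?u, ?v}"
      using eq span_tang[of ?u ?v] by (simp only: u v)
    have "tang x \<in> tang ` span {?u, ?v}" "tang y \<in> tang ` span {?u, ?v}"
      unfolding sp[symmetric] by (auto intro: span_base)
    then have "x \<in> span {?u, ?v}" "y \<in> span {?u, ?v}" using inj_tang by (auto simp: inj_image_mem_iff)
    \<comment> \<open>Expressing x and y back through the new pair shows that its Gram determinant,
      and hence the determinant of the change of basis, is nonzero.\<close>
    then obtain a' b' c' d' where "x = a' *\<^sub>R ?u + b' *\<^sub>R ?v" "y = c' *\<^sub>R ?u + d' *\<^sub>R ?v"
      unfolding span_pair by blast
    then have "gram x y = (a' * d' - b' * c')\<^sup>2 * gram ?u ?v" by (metis gram_change_basis)
    then have "(a * d - b * c)\<^sup>2 \<noteq> 0" using assms by (auto simp: gram_change_basis)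
    then have "R x y y x / gram x y = R ?u ?v ?v ?u / gram ?u ?v"
      unfolding R_change_basis gram_change_basis by simp
    then show "R x y y x / gram x y = curvature_tensor M A g D p u v v u / (g p u u * g p v v - (g p u v)\<^sup>2)"
      unfolding u v gram_g curvature_tensor_tang .
  qed
  show "K = R x y y x / gram x y"
    if "\<forall>u v. span {u, v} = span {tang x, tang y} \<longrightarrow>
      K = curvature_tensor M A g D p u v v u / (g p u u * g p v v - (g p u v)\<^sup>2)" for K
    using that[rule_format, OF refl] by (simp only: gram_g curvature_tensor_tang)
qed

lemma sectional_curvature_hor:
  assumes "hor x y" "G x x \<noteq> 0" "G y y \<noteq> 0"
  shows "sectional_curvature M A g D p (span {tang x, tang y}) = \<kappa> x y"
proof -
  have "gram x y = G x x * G y y" using assms by (simp add: gram_def hor_def)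
  then show ?thesis using sectional_curvature_span[of x y] assms by (simp add: \<kappa>_def)
qed

text \<open>Turns the curvature bound on planes into the bound on \<kappa> that the algebra
  assumes.\<close>

lemma hor_plane:
  assumes "hor x y" "G x x \<noteq> 0" "G y y \<noteq> 0"
  defines "\<alpha> \<equiv> span {tang x, tang y}"
  shows "tangent_plane M A p \<alpha>" "nondegenerate_on g p \<alpha>" "antiholomorphic g J p \<alpha>"
proof -
  have \<alpha>: "\<alpha> = {tang (a *\<^sub>R x + b *\<^sub>R y) | a b. True}"
    unfolding \<alpha>_def span_pair by (simp add: tang_simps)
  have indep: "tang x \<noteq> tang y" "independent {tang x, tang y}"
  proof -
    have ne: "tang x \<noteq> r *\<^sub>R tang y" for r
    proof
      assume "tang x = r *\<^sub>R tang y"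
      then have "tang x = tang (r *\<^sub>R y)" by (simp add: tang_simps)
      then have x: "x = r *\<^sub>R y" by (rule injD[OF inj_tang])
      have "G x x = r * G x y" by (subst (2) x) simp
      then show False using assms by (simp add: hor_def)
    qed
    show "tang x \<noteq> tang y" using ne[of 1] by simp
    have "y \<noteq> 0" using assms by auto
    then show "independent {tang x, tang y}"
      using ne by (auto simp: independent_insert span_singleton)
  qed
  have "dim \<alpha> = 2"
    unfolding \<alpha>_def dim_span using dim_eq_card_independent[OF indep(2)] indep(1) by simp
  moreover have "\<alpha> \<subseteq> TM" unfolding \<alpha> by auto
  ultimately show "tangent_plane M A p \<alpha>" by (simp add: tangent_plane_def \<alpha>_def subspace_span)
  show "nondegenerate_on g p \<alpha>"
    unfolding nondegenerate_on_def
  proof (intro ballI impI)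
    fix u assume "u \<in> \<alpha>" and 0: "\<forall>v\<in>\<alpha>. g p u v = 0"
    then obtain a b where u: "u = tang (a *\<^sub>R x + b *\<^sub>R y)" unfolding \<alpha> by blast
    have "tang x \<in> \<alpha>" "tang y \<in> \<alpha>" by (auto simp: \<alpha>_def intro: span_base)
    then have "G (a *\<^sub>R x + b *\<^sub>R y) x = 0" "G (a *\<^sub>R x + b *\<^sub>R y) y = 0"
      using 0 unfolding G_def u by auto
    then have "a = 0" "b = 0" unfolding hor_comb(1,2)[OF assms(1)] using assms(2,3) by simp_all
    then show "u = 0" by (simp add: u)
  qed
  show "antiholomorphic g J p \<alpha>"
    unfolding antiholomorphic_def
  proof (intro ballI)
    fix u v assume "u \<in> \<alpha>" "v \<in> J p ` \<alpha>"
    then obtain a b c d where "u = tang (a *\<^sub>R x + b *\<^sub>R y)" "v = tang (jj (c *\<^sub>R x + d *\<^sub>R y))"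
      unfolding \<alpha> tang_jj by blast
    then show "g p u v = 0" using hor_comb(3)[OF assms(1)] by (simp add: G_def)
  qed
qed

text \<open>The way back from \<kappa> to planes. An orthogonal basis is enough, because
  antiholomorphy supplies the second half of \<open>hor\<close>.\<close>

lemma antiholomorphic_plane_basis:
  assumes "tangent_plane M A p \<alpha>" "nondegenerate_on g p \<alpha>" "antiholomorphic g J p \<alpha>"
  obtains x y where "\<alpha> = span {tang x, tang y}" "hor x y" "G x x \<noteq> 0" "G y y \<noteq> 0"
proof -
  have \<alpha>: "subspace \<alpha>" "\<alpha> \<subseteq> TM" "dim \<alpha> = 2" using assms(1) by (auto simp: tangent_plane_def)
  obtain B where B: "B \<subseteq> \<alpha>" "\<alpha> \<subseteq> span B" "card B = 2" using basis_exists[of \<alpha>] \<alpha>(3) by metis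
  then obtain u v where uv: "B = {u, v}" by (meson card_2_iff)
  then have "u \<in> range tang" "v \<in> range tang" using B(1) \<alpha>(2) TM_eq by auto
  then obtain x0 y0 where B': "B = {tang x0, tang y0}" using uv by blast
  have "span B \<subseteq> \<alpha>" using B(1) \<alpha>(1) by (rule span_minimal)
  then have \<alpha>0: "\<alpha> = tang ` span {x0, y0}" using B(2) B' span_tang by auto
  obtain x y where xy: "span {x, y} = span {x0, y0}" "G x x \<noteq> 0" "G y y \<noteq> 0" "G x y = 0"
  proof (rule orthogonal_basis)
    fix u assume "u \<in> span {x0, y0}" "\<And>v. v \<in> span {x0, y0} \<Longrightarrow> G u v = 0"
    then have "tang u = 0"
      using assms(2) unfolding nondegenerate_on_def \<alpha>0 G_def by blast
    then show "u = 0" by simp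
  next
    fix x show "\<not> {x0, y0} \<subseteq> span {x}"
    proof
      assume "{x0, y0} \<subseteq> span {x}"
      then have "span {x0, y0} \<subseteq> span {x}" by (rule span_minimal) (rule subspace_span)
      then have "\<alpha> \<subseteq> tang ` span {x}" unfolding \<alpha>0 by (rule image_mono)
      also have "\<dots> = span {tang x}" using span_tang_image[of "{x}"] by simp
      finally have "dim \<alpha> \<le> card {tang x}" by (rule dim_le_card) simp
      then show False using \<alpha>(3) by simp
    qed
  qed (use that in blast)
  have \<alpha>1: "\<alpha> = span {tang x, tang y}" using \<alpha>0 xy(1) span_tang by simp
  then have "tang x \<in> \<alpha>" "tang y \<in> \<alpha>" by (auto intro: span_base)
  then have "g p (tang x) (J p (tang y)) = 0" using assms(3) by (auto simp: antiholomorphic_def)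
  then have "hor x y" using xy(4) by (simp add: hor_def G_def tang_jj)
  then show ?thesis using that \<alpha>1 xy by blast
qed

lemma ex_definite_vectors:
  assumes sig: "metric_signature M A g a b" and "0 < a" "0 < b"
  shows "\<exists>n. G n n < 0" "\<exists>n. G n n > 0"
proof -
  obtain L :: "(nat \<Rightarrow> real) \<Rightarrow> 'a tvec"
    where L: "bij_betw L {x. \<forall>i\<ge>a + b. x i = 0} TM"
      and gL: "\<forall>x y. (\<forall>i\<ge>a + b. x i = 0) \<and> (\<forall>i\<ge>a + b. y i = 0) \<longrightarrow>
           g p (L x) (L y) = - (\<Sum>i<a. x i * y i) + (\<Sum>j=a..<a + b. x j * y j)"
    using bspec[OF sig[unfolded metric_signature_def] p_in] by (elim exE conjE)
  have unit: "\<exists>n. G n n = (if k < a then -1 else 1)" if "k < a + b" for k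
  proof -
    define e where "e = (\<lambda>i. if i = k then 1 else 0 :: real)"
    have e: "\<forall>i\<ge>a + b. e i = 0" using that by (auto simp: e_def)
    then have "L e \<in> TM" using L by (auto simp: bij_betw_def)
    then obtain n where n: "L e = tang n" by (auto simp: TM_eq)
    have ee: "e i * e i = (if i = k then 1 else 0)" for i by (simp add: e_def)
    have "G n n = - (\<Sum>i<a. e i * e i) + (\<Sum>j=a..<a + b. e j * e j)"
      unfolding G_def n[symmetric] by (rule gL[THEN spec, THEN spec, THEN mp, OF conjI[OF e e]])
    also have "\<dots> = (if k < a then -1 else 1)" unfolding ee using that by auto
    finally show ?thesis by blast
  qed
  \<comment> \<open>Index 0 carries a minus sign because a > 0, and index a carries a plus sign
    because b > 0.\<close>
  obtain n n' where "G n n = -1" "G n' n' = 1" using unit[of 0] unit[of a] assms by auto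
  then have "G n n < 0" "G n' n' > 0" by simp_all
  then show "\<exists>n. G n n < 0" "\<exists>n. G n n > 0" by blast+
qed

lemma constant_of_bounded:
  assumes "metric_signature M A g a b" and "0 < a" "0 < b" and "DIM('e) > 4"
    and bound: "\<And>\<alpha>. tangent_plane M A p \<alpha> \<Longrightarrow> nondegenerate_on g p \<alpha> \<Longrightarrow> antiholomorphic g J p \<alpha> \<Longrightarrow>
      sectional_curvature M A g D p \<alpha> \<le> c"
  shows "\<exists>k. \<forall>\<alpha>. tangent_plane M A p \<alpha> \<and> nondegenerate_on g p \<alpha> \<and> antiholomorphic g J p \<alpha> \<longrightarrow>
      sectional_curvature M A g D p \<alpha> = k"
proof -
  interpret bounded_antiholomorphic_curvature G jj R
  proof
    show "DIM('e) > 4" by fact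
    show "\<exists>n. G n n < 0" "\<exists>n. G n n > 0" using ex_definite_vectors assms by blast+
    show "\<exists>c. \<forall>x y. hor x y \<longrightarrow> G x x \<noteq> 0 \<longrightarrow> G y y \<noteq> 0 \<longrightarrow> \<kappa> x y \<le> c"
      using bound[OF hor_plane] sectional_curvature_hor by metis
  qed
  obtain k where "\<And>x y. hor x y \<Longrightarrow> G x x \<noteq> 0 \<Longrightarrow> G y y \<noteq> 0 \<Longrightarrow> \<kappa> x y = k"
    using \<kappa>_constant by blast
  then show ?thesis
    using antiholomorphic_plane_basis sectional_curvature_hor by metis
qed

end

theorem theorem2:
  fixes M :: "'a topology" and A :: "('a, 'e::euclidean_space) chart set"
    and g :: "'a \<Rightarrow> 'a tvec \<Rightarrow> 'a tvec \<Rightarrow> real"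
    and J :: "'a \<Rightarrow> 'a tvec \<Rightarrow> 'a tvec"
    and nabla :: "'a vfield \<Rightarrow> 'a vfield \<Rightarrow> 'a vfield"
    and m s :: nat
  assumes "almost_hermitian_manifold M A g J"
    and "DIM('e) = 2 * m"
    and "metric_signature M A g (2 * s) (2 * (m - s))"
    and "0 < s" and "s < m" and "m > 2"
    and "levi_civita_connection M A g nabla"
    and "\<forall>p\<in>topspace M. \<exists>c. \<forall>\<alpha>.
           tangent_plane M A p \<alpha> \<and> nondegenerate_on g p \<alpha> \<and> antiholomorphic g J p \<alpha> \<longrightarrow>
           sectional_curvature M A g nabla p \<alpha> \<le> c"
  shows "pointwise_constant_antiholomorphic_curvature M A g J nabla"
  unfolding pointwise_constant_antiholomorphic_curvature_def
proof
  fix p assume p: "p \<in> topspace M"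
  interpret metric_connection M A nabla g
  proof
    show "smooth_manifold M A" "pseudo_riemannian_metric M A g"
      using assms(1) by (auto simp: almost_hermitian_manifold_def)
    show "affine_connection M A nabla" using assms(7) by (simp add: levi_civita_connection_def)
    show "nabla X Y p - nabla Y X p = lie_bracket M A X Y p"
      if "openin M W" "smooth_vfield M A W X" "smooth_vfield M A W Y" "p \<in> W" for W X Y p
      using assms(7) that unfolding levi_civita_connection_def by blast
    show "X p (\<lambda>q. g q (Y q) (Z q)) = g p (nabla X Y p) (Z p) + g p (Y p) (nabla X Z p)"
      if "openin M W" "smooth_vfield M A W X" "smooth_vfield M A W Y" "smooth_vfield M A W Z" "p \<in> W" for W X Y Z p
      using assms(7)[unfolded levi_civita_connection_def, THEN conjunct2, THEN conjunct2, rule_format, of W X Y Z p]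
        that by simp
  qed
  obtain U \<phi> where c: "(U, \<phi>) \<in> A" "p \<in> U" using p by (rule chart_at)
  interpret almost_hermitian_point M A nabla g J p U \<phi>
    by standard (use assms(1) c in auto)
  obtain c where bound: "\<And>\<alpha>. tangent_plane M A p \<alpha> \<Longrightarrow> nondegenerate_on g p \<alpha> \<Longrightarrow> antiholomorphic g J p \<alpha> \<Longrightarrow>
      sectional_curvature M A g nabla p \<alpha> \<le> c"
    using assms(8) p by blast
  \<comment> \<open>From 0 < s < m both signs occur, and m > 2 makes the real dimension exceed
    4.\<close>
  show "\<exists>k. \<forall>\<alpha>. tangent_plane M A p \<alpha> \<and> nondegenerate_on g p \<alpha> \<and> antiholomorphic g J p \<alpha> \<longrightarrow>
      sectional_curvature M A g nabla p \<alpha> = k"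
    by (rule constant_of_bounded[OF assms(3) _ _ _ bound]) (use assms(2,4-6) in auto)
qed

end
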